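(* Let $G$ be a finite connected simple graph and let $m=\operatorname{rank}(H_1(G))$. Let $\gamma_1,\ldots,\gamma_m$ be a lexicographically shortest basis of $H_1(G)$, and let $l_i$ be the length of the loop $\gamma_i$. Then, as multisets (with diagonal points $(1,1)$ on the right-hand side ignored), $$\mathrm{PD}_1(G)=\left\{\left(1,\left\lceil \tfrac{l_i}{3}\right\rceil\right)\;\middle|\; 1\le i\le m\right\}.$$
   Context: All homology is simplicial homology with $\mathbb{Z}/2\mathbb{Z}$ coefficients. For a finite connected simple graph $G$ with vertex set $\mathcal{V}$, let $\rho(v,w)$ be the number of edges in a shortest path in $G$ from $v$ to $w$, and let $D=\operatorname{diam}(G)=\max_{v,w\in\mathcal{V}}\rho(v,w)$. For an integer $n\ge 0$, the graph power $G^n$ has vertex set $\mathcal{V}$ and an edge between distinct vertices $v,w$ whenever $\rho(v,w)\le n$. Let $\widehat{G}^n$ be the clique complex of $G^n$: the simplicial complex on $\mathcal{V}$ whose simplices are the nonempty finite sets of vertices with pairwise $\rho$-distances at most $n$. The power filtration is $\widehat{G}^0\subset\widehat{G}^1\subset\cdots\subset\widehat{G}^D$. Persistence diagram: the persistence module $H_k(\widehat{G}^0)\to H_k(\widehat{G}^1)\to\cdots\to H_k(\widehat{G}^D)$ (maps induced by inclusions) decomposes uniquely up to reordering as a direct sum $\bigoplus_{i=1}^N \mathbb{I}_{b_i,d_i}$ of interval modules with $b_i<d_i$, where $\mathbb{I}_{b,d}$ is $\mathbb{Z}/2\mathbb{Z}$ at indices $b,b+1,\ldots,d-1$ with identity maps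 between them, and is $0$ elsewhere (by convention $d=\infty$ if the interval reaches index $D$). $\mathrm{PD}_k(G)$ is the multiset $\{(b_i,d_i)\mid 1\le i\le N\}$. Points $(b,d)$ with $b=d$ are on the diagonal and are ignored when describing a persistence diagram; in particular, a loop of length $l_i=3$ gives the diagonal point $(1,1)$, which is ignored. A path of length $l$ in $G$ is a sequence of vertices $v_0,\ldots,v_l$ with each $[v_i,v_{i+1}]$ an edge of $G$; it is a loop of length $l$ if $v_l=v_0$. $H_1(G)$ denotes the first homology of the graph $G$ itself, viewed as a 1-dimensional simplicial complex. Loops $\gamma_1,\ldots,\gamma_m$ in $G$ whose homology classes form a basis of $H_1(G)$, ordered so that their lengths satisfy $l_1\le l_2\le\cdots\le l_m$, are called a lexicographically shortest basis of $H_1(G)$ if the sequence $(l_1,\ldots,l_m)$ is lexicographically smallest among the non-decreasing length sequences of all bases of $H_1(G)$ given by loops. $\lceil x\rceil$ is the smallest integer $\ge x$. *)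

theory Defs
  imports
    "HOL-Algebra.AbelCoset"
    "Jordan_Normal_Form.VS_Connect"
    "Graph_Theory.Graph_Theory"
    "HOL-Library.Z2"
    "HOL-Library.Extended_Nat"
begin

hide_const (open) Multiset.mult  (* would capture the record field of the same name *)

section \<open>Vector spaces over the field with two elements\<close>

abbreviation F2 :: "bit ring" where
  "F2 \<equiv> class_ring"

text \<open>A vector space is a \<^type>\<open>module\<close> record; its ring fields \<open>mult\<close> and \<open>one\<close> play no role
  and are left undefined below.\<close>

definition quotient_space :: "(bit, 'm) module \<Rightarrow> 'm set \<Rightarrow> (bit, 'm set) module" where
  "quotient_space M N =
    \<lparr>carrier = a_rcosets\<^bsub>M\<^esub> N, mult = undefined, one = undefined,
     zero = N, add = (\<lambda>X Y. X <+>\<^bsub>M\<^esub> Y),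
     smult = (\<lambda>a X. \<Union>x\<in>X. N +>\<^bsub>M\<^esub> (a \<odot>\<^bsub>M\<^esub> x))\<rparr>"

definition linear_iso :: "(bit, 'm) module \<Rightarrow> (bit, 'n) module \<Rightarrow> ('m \<Rightarrow> 'n) \<Rightarrow> bool" where
  "linear_iso V W \<phi> \<longleftrightarrow> linear_map F2 V W \<phi> \<and> bij_betw \<phi> (carrier V) (carrier W)"

section \<open>Simplicial homology modulo 2\<close>

text \<open>A simplicial complex is given by its set of simplices, each a nonempty finite set of vertices.
  A \<open>k\<close>-simplex has \<open>k + 1\<close> vertices.\<close>

definition chain_space :: "'v set set \<Rightarrow> nat \<Rightarrow> (bit, 'v set \<Rightarrow> bit) module" where
  "chain_space K k =
    \<lparr>carrier = {c. finite {s. c s \<noteq> 0} \<and> (\<forall>s. c s \<noteq> 0 \<longrightarrow> s \<in> K \<and> card s = Suc k)},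
     mult = undefined, one = undefined,
     zero = (\<lambda>s. 0), add = (\<lambda>c d s. c s + d s), smult = (\<lambda>a c s. a * c s)\<rparr>"

text \<open>The coefficient of \<open>\<partial>c\<close> at \<open>t\<close> is the sum of the coefficients of \<open>c\<close> at all simplices that have
  \<open>t\<close> as a facet. The empty face is excluded, so \<open>\<partial>\<close> vanishes on 0-chains (the homology is
  unreduced).\<close>

definition boundary :: "('v set \<Rightarrow> bit) \<Rightarrow> ('v set \<Rightarrow> bit)" where
  "boundary c = (\<lambda>t. if t = {} then 0
     else \<Sum>s\<in>{s. c s \<noteq> 0 \<and> (\<exists>v. v \<notin> t \<and> s = insert v t)}. c s)"

definition cycles :: "'v set set \<Rightarrow> nat \<Rightarrow> ('v set \<Rightarrow> bit) set" where
  "cycles K k = {c \<in> carrier (chain_space K k). boundary c = (\<lambda>s. 0)}"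

definition boundaries :: "'v set set \<Rightarrow> nat \<Rightarrow> ('v set \<Rightarrow> bit) set" where
  "boundaries K k = boundary ` carrier (chain_space K (Suc k))"

definition homology :: "nat \<Rightarrow> 'v set set \<Rightarrow> (bit, ('v set \<Rightarrow> bit) set) module" where
  "homology k K = quotient_space ((chain_space K k)\<lparr>carrier := cycles K k\<rparr>) (boundaries K k)"

definition homology_class :: "nat \<Rightarrow> 'v set set \<Rightarrow> ('v set \<Rightarrow> bit) \<Rightarrow> ('v set \<Rightarrow> bit) set" where
  "homology_class k K c = boundaries K k +>\<^bsub>chain_space K k\<^esub> c"

text \<open>The map into the homology of \<open>L\<close> induced by the inclusion of a subcomplex of \<open>L\<close>. All cycles
  in a class \<open>X\<close> of the subcomplex have the same class in \<open>L\<close>, so the union below is that class.\<close>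

definition inclusion_map ::
  "nat \<Rightarrow> 'v set set \<Rightarrow> ('v set \<Rightarrow> bit) set \<Rightarrow> ('v set \<Rightarrow> bit) set" where
  "inclusion_map k L X = (\<Union>c\<in>X. homology_class k L c)"

section \<open>Persistence modules and their diagrams\<close>

text \<open>A persistence module indexed by \<open>0, \<dots>, D\<close> consists of spaces \<open>M i\<close> for \<open>i \<le> D\<close> and maps \<open>f i\<close>
  from \<open>M i\<close> to \<open>M (i + 1)\<close> for \<open>i < D\<close>. An interval \<open>(b, d)\<close> is alive at \<open>b, \<dots>, d - 1\<close>.\<close>

definition alive :: "nat \<times> enat \<Rightarrow> nat \<Rightarrow> bool" where
  "alive I i \<longleftrightarrow> fst I \<le> i \<and> enat i < snd I"

definition interval_carrier :: "nat \<times> enat \<Rightarrow> nat \<Rightarrow> bit set" where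
  "interval_carrier I i = (if alive I i then UNIV else {0})"

definition interval_map :: "nat \<times> enat \<Rightarrow> nat \<Rightarrow> bit \<Rightarrow> bit" where
  "interval_map I i x = (if alive I i \<and> alive I (Suc i) then x else 0)"

text \<open>The direct sum of the interval modules in the list \<open>Is\<close>: its elements are families of
  components indexed by \<open>j < length Is\<close>, extended by 0.\<close>

definition interval_sum_space :: "(nat \<times> enat) list \<Rightarrow> nat \<Rightarrow> (bit, nat \<Rightarrow> bit) module" where
  "interval_sum_space Is i =
    \<lparr>carrier = {x. (\<forall>j<length Is. x j \<in> interval_carrier (Is ! j) i) \<and> (\<forall>j\<ge>length Is. x j = 0)},
     mult = undefined, one = undefined,
     zero = (\<lambda>j. 0), add = (\<lambda>x y j. x j + y j), smult = (\<lambda>a x j. a * x j)\<rparr>"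

definition interval_sum_map :: "(nat \<times> enat) list \<Rightarrow> nat \<Rightarrow> (nat \<Rightarrow> bit) \<Rightarrow> (nat \<Rightarrow> bit)" where
  "interval_sum_map Is i x = (\<lambda>j. if j < length Is then interval_map (Is ! j) i (x j) else 0)"

text \<open>An interval that reaches the last index \<open>D\<close> has \<open>d = \<infinity>\<close>; any other has \<open>d \<le> D\<close>.\<close>

definition valid_interval :: "nat \<Rightarrow> nat \<times> enat \<Rightarrow> bool" where
  "valid_interval D I \<longleftrightarrow>
     fst I \<le> D \<and> enat (fst I) < snd I \<and> (snd I = \<infinity> \<or> snd I \<le> enat D)"

definition interval_decomposition ::
  "nat \<Rightarrow> (nat \<Rightarrow> (bit, 'm) module) \<Rightarrow> (nat \<Rightarrow> 'm \<Rightarrow> 'm) \<Rightarrow> (nat \<times> enat) list \<Rightarrow> bool" where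
  "interval_decomposition D M f Is \<longleftrightarrow>
     (\<forall>I\<in>set Is. valid_interval D I) \<and>
     (\<exists>\<phi>. (\<forall>i\<le>D. linear_iso (M i) (interval_sum_space Is i) (\<phi> i)) \<and>
          (\<forall>i<D. \<forall>x\<in>carrier (M i). \<phi> (Suc i) (f i x) = interval_sum_map Is i (\<phi> i x)))"

definition persistence_diagram ::
  "nat \<Rightarrow> (nat \<Rightarrow> (bit, 'm) module) \<Rightarrow> (nat \<Rightarrow> 'm \<Rightarrow> 'm) \<Rightarrow> (nat \<times> enat) multiset" where
  "persistence_diagram D M f = (THE P. \<exists>Is. P = mset Is \<and> interval_decomposition D M f Is)"

section \<open>Graphs and the power filtration\<close>

text \<open>A finite simple graph is a \<^locale>\<open>pair_graph\<close>: a finite loopless digraph with a symmetric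
  arc relation. A path in the graph is a \<^const>\<open>vwalk\<close>, where vertices and edges may be repeated.\<close>

definition graph_dist :: "'v pair_pre_digraph \<Rightarrow> 'v \<Rightarrow> 'v \<Rightarrow> nat" where
  "graph_dist G v w =
     (LEAST n. \<exists>p. vwalk p (with_proj G) \<and> hd p = v \<and> last p = w \<and> vwalk_length p = n)"

definition graph_diam :: "'v pair_pre_digraph \<Rightarrow> nat" where
  "graph_diam G = Max {graph_dist G v w | v w. v \<in> pverts G \<and> w \<in> pverts G}"

text \<open>The clique complex of the \<open>n\<close>-th graph power.\<close>

definition power_complex :: "'v pair_pre_digraph \<Rightarrow> nat \<Rightarrow> 'v set set" where
  "power_complex G n =
     {s. s \<subseteq> pverts G \<and> finite s \<and> s \<noteq> {} \<and> (\<forall>v\<in>s. \<forall>w\<in>s. graph_dist G v w \<le> n)}"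

definition PD :: "nat \<Rightarrow> 'v pair_pre_digraph \<Rightarrow> (nat \<times> enat) multiset" where
  "PD k G = persistence_diagram (graph_diam G)
     (\<lambda>i. homology k (power_complex G i))
     (\<lambda>i. inclusion_map k (power_complex G (Suc i)))"

section \<open>Lexicographically shortest loop bases\<close>

definition graph_complex :: "'v pair_pre_digraph \<Rightarrow> 'v set set" where
  "graph_complex G = {{v} | v. v \<in> pverts G} \<union> {{v, w} | v w. (v, w) \<in> parcs G}"

definition is_loop :: "'v pair_pre_digraph \<Rightarrow> 'v vwalk \<Rightarrow> bool" where
  "is_loop G p \<longleftrightarrow> vwalk p (with_proj G) \<and> last p = hd p"

text \<open>The sum modulo 2 of the edges traversed by a loop, counted with multiplicity.\<close>

definition loop_chain :: "'v vwalk \<Rightarrow> ('v set \<Rightarrow> bit)" where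
  "loop_chain p = (\<lambda>e. \<Sum>(u, v)\<leftarrow>vwalk_arcs p. of_bool ({u, v} = e))"

definition loop_class :: "'v pair_pre_digraph \<Rightarrow> 'v vwalk \<Rightarrow> ('v set \<Rightarrow> bit) set" where
  "loop_class G p = homology_class 1 (graph_complex G) (loop_chain p)"

definition loop_basis :: "'v pair_pre_digraph \<Rightarrow> 'v vwalk list \<Rightarrow> bool" where
  "loop_basis G \<gamma> \<longleftrightarrow>
     (\<forall>p\<in>set \<gamma>. is_loop G p) \<and> distinct (map (loop_class G) \<gamma>) \<and>
     vectorspace.basis F2 (homology 1 (graph_complex G)) (set (map (loop_class G) \<gamma>))"

definition lex_shortest_loop_basis :: "'v pair_pre_digraph \<Rightarrow> 'v vwalk list \<Rightarrow> bool" where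
  "lex_shortest_loop_basis G \<gamma> \<longleftrightarrow>
     loop_basis G \<gamma> \<and> sorted (map vwalk_length \<gamma>) \<and>
     (\<forall>\<gamma>'. loop_basis G \<gamma>' \<and> sorted (map vwalk_length \<gamma>') \<longrightarrow>
        ord_class.lexordp_eq (map vwalk_length \<gamma>) (map vwalk_length \<gamma>'))"

end

theory Submission
  imports Defs "HOL-Library.Function_Algebras"
begin

text \<open>Replacing every edge of a power complex by a shortest path between its ends is a chain
  retraction onto \<open>G\<close>. An edge of the \<open>n\<close>-th power complex is homologous there to its path, and the
  retraction sends the boundary of a triangle to a loop of length at most \<open>3 n\<close>. Conversely, a loop of
  length at most \<open>3 n\<close> splits into three arcs of length at most \<open>n\<close>, so it is the boundary of a triangle
  up to homology. Hence, for \<open>n \<ge> 1\<close>, the first homology of the \<open>n\<close>-th power complex is that of \<open>G\<close> modulo the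
  loops of length at most \<open>3 n\<close>. By the exchange property those loops are spanned by the members
  of length at most \<open>3 n\<close> of a lexicographically shortest basis. The coordinates of the retraction in
  that basis decompose the persistence module into intervals, and the ranks of its maps
  make the decomposition unique.\<close>

section \<open>Uniqueness of persistence diagrams\<close>

text \<open>The diagram is a definite description, so one decomposition is not enough: uniqueness
  has to be proved as well. Over the field with two elements the rank of a map is visible in the
  size of its image, and these sizes determine every multiplicity. The retraction is a single map
  for all indices. In its coordinates the inclusion of one power complex into the next merely
  forgets the basis loops that have just become fillable, so compatibility with the structure maps
  is nearly free. Only the step out of index 0 is special: there are no edges there, so the first
  homology vanishes and every interval is born at 1. At the last index all vertices span one simplex
  and every loop bounds, so no interval is infinite. Homology is given by records of cosets.
  Injective linear maps into spaces of bit-valued functions turn questions about these records into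
  questions about functions, where spans and coordinates are at hand.\<close>

lemma alive_both_iff: "i \<le> j \<Longrightarrow> alive I i \<and> alive I j \<longleftrightarrow> fst I \<le> i \<and> enat j < snd I"
  by (auto simp: alive_def) (meson enat_ord_simps(1) le_less_trans)

lemma size_filter_eq_count: "size {#x \<in># M. x = a#} = count M a"
  by (simp add: filter_eq_replicate_mset)

text \<open>The hypothesis counts the intervals born by \<open>i\<close> that outlive
  \<open>j\<close>. The difference of these counts for the birth bounds \<open>b\<close> and
  \<open>b - 1\<close> isolates the intervals born exactly at \<open>b\<close>.\<close>

lemma size_filter_fst_eq:
  assumes rank: "\<And>i j. i \<le> j \<Longrightarrow> j \<le> D \<Longrightarrow>
      size {#I \<in># P. alive I i \<and> alive I j#} = size {#I \<in># Q. alive I i \<and> alive I j#}"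
    and be: "b \<le> e" "e \<le> D"
  shows "size {#I \<in># P. fst I = b \<and> enat e < snd I#} = size {#I \<in># Q. fst I = b \<and> enat e < snd I#}"
proof -
  have rank': "size {#I \<in># P. fst I \<le> i \<and> enat j < snd I#} = size {#I \<in># Q. fst I \<le> i \<and> enat j < snd I#}"
    if "i \<le> j" "j \<le> D" for i j
    using rank[OF that] by (simp add: alive_both_iff[OF that(1)])
  show ?thesis
  proof (cases b)
    case 0
    then show ?thesis using rank'[OF be] by simp
  next
    case (Suc a)
    have "size {#I \<in># M. fst I \<le> b \<and> enat e < snd I#} =
        size {#I \<in># M. fst I = b \<and> enat e < snd I#} + size {#I \<in># M. fst I \<le> a \<and> enat e < snd I#}"
      for M :: "(nat \<times> enat) multiset"
      unfolding Suc by (induction M) auto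
    then show ?thesis using rank'[of a e] rank'[OF be] Suc be by simp
  qed
qed

text \<open>A second difference of the rank counts gives each multiplicity: the intervals
  \<open>(b, Suc a)\<close> are those born at \<open>b\<close> and alive at \<open>a\<close>, less
  those still alive at \<open>Suc a\<close>.\<close>

lemma interval_mset_eqI:
  assumes rank: "\<And>i j. i \<le> j \<Longrightarrow> j \<le> D \<Longrightarrow>
      size {#I \<in># P. alive I i \<and> alive I j#} = size {#I \<in># Q. alive I i \<and> alive I j#}"
    and P: "\<forall>I\<in>#P. valid_interval D I" and Q: "\<forall>I\<in>#Q. valid_interval D I"
  shows "P = Q"
proof (rule multiset_eqI)
  fix I :: "nat \<times> enat"
  obtain b d where I: "I = (b, d)" by fastforce
  show "count P I = count Q I"
  proof (cases "valid_interval D I")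
    case False
    then show ?thesis using P Q by (metis not_in_iff)
  next
    case True
    show ?thesis
    proof (cases d)
      case infinity
      have "count M I = size {#J \<in># M. fst J = b \<and> enat D < snd J#}" if "\<forall>J\<in>#M. valid_interval D J" for M
      proof -
        \<comment> \<open>Validity allows no finite end beyond \<open>D\<close>, so outliving
          \<open>D\<close> means being infinite.\<close>
        have "{#J \<in># M. fst J = b \<and> enat D < snd J#} = {#J \<in># M. J = I#}"
          using that infinity by (intro filter_mset_cong) (auto simp: valid_interval_def I dest!: leD)
        then show ?thesis by (simp add: size_filter_eq_count)
      qed
      then show ?thesis using size_filter_fst_eq[OF rank, of D b D] P Q True
        by (simp add: valid_interval_def I)
    next
      case (enat e)
      with True obtain a where e: "e = Suc a" "b \<le> a" "e \<le> D"
        by (cases e) (auto simp: valid_interval_def I)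
      have less: "enat a < x \<longleftrightarrow> x = enat e \<or> enat e < x" for x
        using e by (cases x) auto
      have "size {#J \<in># M. fst J = b \<and> enat a < snd J#} =
          count M I + size {#J \<in># M. fst J = b \<and> enat e < snd J#}" for M
        unfolding size_filter_eq_count[symmetric] I enat by (induction M) (auto simp: less)
      from this[of P] this[of Q] show ?thesis
        using size_filter_fst_eq[OF rank, of D b a] size_filter_fst_eq[OF rank, of D b e] e by simp
    qed
  qed
qed

section \<open>Ranks of the composite maps, measured by cardinalities\<close>

primrec transition :: "(nat \<Rightarrow> 'm \<Rightarrow> 'm) \<Rightarrow> nat \<Rightarrow> nat \<Rightarrow> 'm \<Rightarrow> 'm" where
  "transition f i 0 x = x"
| "transition f i (Suc k) x = f (i + k) (transition f i k x)"

text \<open>A lifespan has no gaps: an interval alive at both ends is alive at every index between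
  them, so its coordinate survives all the intermediate maps.\<close>

lemma transition_interval_sum:
  assumes "x \<in> carrier (interval_sum_space Is i)"
  shows "transition (interval_sum_map Is) i k x =
    (\<lambda>j. if j < length Is \<and> alive (Is ! j) i \<and> alive (Is ! j) (i + k) then x j else 0)"
proof (induction k)
  case 0
  have "x j = 0" if "\<not> (j < length Is \<and> alive (Is ! j) i)" for j
    using assms that by (cases "j < length Is") (auto simp: interval_sum_space_def interval_carrier_def)
  then show ?case by (auto simp: fun_eq_iff)
next
  case (Suc k)
  have "alive I (i + k)" if "alive I i" "alive I (Suc (i + k))" for I
    using that by (auto simp: alive_def) (meson Suc_n_not_le_n enat_ord_simps(1) le_less_trans linear)
  then show ?case unfolding transition.simps Suc
    by (auto simp: interval_sum_map_def interval_map_def fun_eq_iff)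
qed

lemma card_bit_functions_supported:
  assumes "finite S"
  shows "card {x :: 'i \<Rightarrow> bit. \<forall>j. x j \<noteq> 0 \<longrightarrow> j \<in> S} = 2 ^ card S"
proof -
  have "bij_betw (\<lambda>x. {j. x j \<noteq> 0}) {x :: 'i \<Rightarrow> bit. \<forall>j. x j \<noteq> 0 \<longrightarrow> j \<in> S} (Pow S)"
    by (rule bij_betw_byWitness[where f' = "\<lambda>T j. of_bool (j \<in> T)"]) (auto simp: fun_eq_iff)
  then show ?thesis using assms by (simp add: bij_betw_same_card card_Pow)
qed

text \<open>Cardinality stands in for rank: the image consists of all bit vectors supported on the
  intervals alive at both ends.\<close>

lemma card_transition_interval_sum:
  "card (transition (interval_sum_map Is) i k ` carrier (interval_sum_space Is i)) =
    2 ^ size {#I \<in># mset Is. alive I i \<and> alive I (i + k)#}"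
proof -
  let ?S = "{j. j < length Is \<and> alive (Is ! j) i \<and> alive (Is ! j) (i + k)}"
  have "transition (interval_sum_map Is) i k ` carrier (interval_sum_space Is i) =
     {x. \<forall>j. x j \<noteq> 0 \<longrightarrow> j \<in> ?S}" (is "?L = ?R")
  proof (intro equalityI subsetI)
    fix x assume x: "x \<in> ?R"
    then have c: "x \<in> carrier (interval_sum_space Is i)"
      by (fastforce simp: interval_sum_space_def interval_carrier_def)
    have "transition (interval_sum_map Is) i k x = x"
      unfolding transition_interval_sum[OF c] using x by (auto simp: fun_eq_iff)
    then show "x \<in> ?L" using c by (metis image_eqI)
  next
    fix x assume "x \<in> ?L"
    then obtain y where "y \<in> carrier (interval_sum_space Is i)" "x = transition (interval_sum_map Is) i k y"
      by blast
    then show "x \<in> ?R" by (simp add: transition_interval_sum)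
  qed
  moreover have "card ?R = 2 ^ card ?S"
    by (rule card_bit_functions_supported) (rule finite_subset[of _ "{..<length Is}"], auto)
  moreover have "card ?S = size {#I \<in># mset Is. alive I i \<and> alive I (i + k)#}"
    by (simp add: length_filter_conv_card flip: mset_filter)
  ultimately show ?thesis by simp
qed

text \<open>The isomorphisms conjugate the composites of \<open>f\<close> into masks. Since the
  left-hand side does not mention \<open>Is\<close>, the exponent is an invariant of the persistence
  module. The assumption on \<open>f\<close> keeps images inside the carriers, where the
  isomorphisms are injective; \<open>interval_decomposition\<close> itself does not demand
  this.\<close>

lemma interval_decomposition_card_transition:
  assumes dec: "interval_decomposition D M f Is"
    and f: "\<And>i x. i < D \<Longrightarrow> x \<in> carrier (M i) \<Longrightarrow> f i x \<in> carrier (M (Suc i))"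
    and ik: "i + k \<le> D"
  shows "card (transition f i k ` carrier (M i)) = 2 ^ size {#I \<in># mset Is. alive I i \<and> alive I (i + k)#}"
proof -
  obtain \<phi> where iso: "\<And>i. i \<le> D \<Longrightarrow> bij_betw (\<phi> i) (carrier (M i)) (carrier (interval_sum_space Is i))"
    and comm: "\<And>i x. i < D \<Longrightarrow> x \<in> carrier (M i) \<Longrightarrow> \<phi> (Suc i) (f i x) = interval_sum_map Is i (\<phi> i x)"
    using dec unfolding interval_decomposition_def linear_iso_def by blast
  have tr: "transition f i k x \<in> carrier (M (i + k)) \<and>
      \<phi> (i + k) (transition f i k x) = transition (interval_sum_map Is) i k (\<phi> i x)"
    if "x \<in> carrier (M i)" "i + k \<le> D" for x k
    using that(2)
  proof (induction k)
    case (Suc k)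
    then show ?case using f[of "i + k"] comm[of "i + k"] by simp
  qed (use that in simp)
  have "card (transition f i k ` carrier (M i)) = card (\<phi> (i + k) ` transition f i k ` carrier (M i))"
    using tr ik by (intro card_image[symmetric] inj_on_subset[OF bij_betw_imp_inj_on[OF iso]]) auto
  also have "\<phi> (i + k) ` transition f i k ` carrier (M i) =
      transition (interval_sum_map Is) i k ` \<phi> i ` carrier (M i)"
    using tr[OF _ ik] by (auto simp: image_iff) 
  also have "\<phi> i ` carrier (M i) = carrier (interval_sum_space Is i)"
    using iso[of i] ik by (simp add: bij_betw_imp_surj_on)
  finally show ?thesis by (simp add: card_transition_interval_sum)
qed

text \<open>Any other decomposition yields the same image sizes, hence the same exponents of 2,
  hence the same rank counts, and these determine the multiset.\<close>

lemma persistence_diagram_eqI: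
  assumes dec: "interval_decomposition D M f Is"
    and f: "\<And>i x. i < D \<Longrightarrow> x \<in> carrier (M i) \<Longrightarrow> f i x \<in> carrier (M (Suc i))"
  shows "persistence_diagram D M f = mset Is"
  unfolding persistence_diagram_def
proof (rule the_equality)
  fix P assume "\<exists>Js. P = mset Js \<and> interval_decomposition D M f Js"
  then obtain Js where Js: "P = mset Js" "interval_decomposition D M f Js" by blast
  have "mset Js = mset Is"
  proof (rule interval_mset_eqI)
    fix i j assume "i \<le> j" "j \<le> D"
    then have "(2::nat) ^ size {#I \<in># mset Js. alive I i \<and> alive I j#} =
      2 ^ size {#I \<in># mset Is. alive I i \<and> alive I j#}"
      using interval_decomposition_card_transition[OF dec f, of i "j - i"]
        interval_decomposition_card_transition[OF Js(2) f, of i "j - i"] by simp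
    then show "size {#I \<in># mset Js. alive I i \<and> alive I j#} = size {#I \<in># mset Is. alive I i \<and> alive I j#}"
      by simp
  qed (use dec Js in \<open>auto simp: interval_decomposition_def\<close>)
  then show "P = mset Is" using Js by simp
qed (use dec in blast)

section \<open>Vector spaces of functions to the field with two elements\<close>

text \<open>The first two rules turn the ring operations on \<^typ>\<open>bit\<close> into bitwise ones, to which the
  algebraic simplification rules do not apply.\<close>

declare add_bit_eq_xor [simp del] mult_bit_eq_and [simp del] bit_not_zero_iff [simp del]

text \<open>This is the scaling of \<open>chain_space\<close> and \<open>interval_sum_space\<close>,
  named so that the locale \<open>vector_space\<close> can be interpreted with it. Its
  \<open>span\<close>, \<open>independent\<close> and \<open>representation\<close> carry the linear
  algebra below.\<close>

definition bscale :: "bit \<Rightarrow> ('i \<Rightarrow> bit) \<Rightarrow> 'i \<Rightarrow> bit" where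
  "bscale a c = (\<lambda>s. a * c s)"

interpretation bit_fun: vector_space "bscale :: bit \<Rightarrow> ('i \<Rightarrow> bit) \<Rightarrow> 'i \<Rightarrow> bit"
  by unfold_locales (simp_all add: bscale_def fun_eq_iff algebra_simps)

lemma bscale_simps [simp]: "bscale 0 c = 0" "bscale 1 c = c"
  by (simp_all add: bscale_def fun_eq_iff)

lemma bit_fun_add_self [simp]: "c + c = 0" for c :: "'i \<Rightarrow> bit"
proof
  show "(c + c) s = 0 s" for s by (cases "c s") simp_all
qed

lemma bit_fun_add_self_left [simp]: "c + (c + d) = d" for c d :: "'i \<Rightarrow> bit"
  by (simp flip: add.assoc)

text \<open>The only scalars are 0 and 1, so closure under addition is enough.\<close>

lemma bit_fun_subspaceI:
  assumes "0 \<in> S" "\<And>x y. x \<in> S \<Longrightarrow> y \<in> S \<Longrightarrow> x + y \<in> S"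
  shows "bit_fun.subspace S"
proof (rule bit_fun.subspaceI)
  fix a :: bit and x :: "'a \<Rightarrow> bit"
  assume "x \<in> S" then show "bscale a x \<in> S" using assms by (cases a) simp_all
qed (use assms in auto)

text \<open>The vector space laws of the record \<open>V\<close> are pulled back along an injective
  linear map \<open>g\<close> into bit-valued functions. For homology this avoids verifying them on
  cosets.\<close>

locale bit_space_embedding =
  fixes V :: "(bit, 'm) module" and g :: "'m \<Rightarrow> 'i \<Rightarrow> bit"
  assumes zero_closed: "\<zero>\<^bsub>V\<^esub> \<in> carrier V" and g_zero: "g \<zero>\<^bsub>V\<^esub> = 0"
    and add_closed: "x \<in> carrier V \<Longrightarrow> y \<in> carrier V \<Longrightarrow> x \<oplus>\<^bsub>V\<^esub> y \<in> carrier V"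
    and g_add: "x \<in> carrier V \<Longrightarrow> y \<in> carrier V \<Longrightarrow> g (x \<oplus>\<^bsub>V\<^esub> y) = g x + g y"
    and scale_closed: "x \<in> carrier V \<Longrightarrow> a \<odot>\<^bsub>V\<^esub> x \<in> carrier V"
    and g_scale: "x \<in> carrier V \<Longrightarrow> g (a \<odot>\<^bsub>V\<^esub> x) = bscale a (g x)"
    and inj: "inj_on g (carrier V)"
begin

lemma eqI: "g x = g y \<Longrightarrow> x \<in> carrier V \<Longrightarrow> y \<in> carrier V \<Longrightarrow> x = y"
  using inj by (rule inj_onD)

lemma vectorspace: "vectorspace F2 V"
proof -
  have "abelian_group V"
  proof (rule abelian_groupI)
    fix x assume "x \<in> carrier V"
    then show "\<exists>y\<in>carrier V. y \<oplus>\<^bsub>V\<^esub> x = \<zero>\<^bsub>V\<^esub>"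
      by (intro bexI[of _ x] eqI) (simp_all add: g_add g_zero add_closed zero_closed)
  qed (auto intro!: eqI simp: g_add g_zero add_closed zero_closed add_ac)
  moreover have "module_axioms F2 V"
    by unfold_locales
      (auto intro!: eqI simp: g_add g_scale add_closed scale_closed
        bit_fun.scale_left_distrib bit_fun.scale_right_distrib)
  ultimately show ?thesis
    by (intro vectorspace.intro Module.module.intro class_cring.is_cring class_field)
qed

sublocale vectorspace F2 V by (rule vectorspace)

lemma g_lincomb:
  assumes "finite A" "A \<subseteq> carrier V"
  shows "g (lincomb a A) = (\<Sum>v\<in>A. bscale (a v) (g v))"
  using assms
proof (induction A)
  case empty
  then show ?case by (simp add: lincomb_def g_zero)
next
  case (insert v A)
  have sub: "(\<lambda>v. a v \<odot>\<^bsub>V\<^esub> v) \<in> A \<rightarrow> carrier V" "a v \<odot>\<^bsub>V\<^esub> v \<in> carrier V"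
    using insert.prems by (auto intro: scale_closed)
  then have "lincomb a (insert v A) = a v \<odot>\<^bsub>V\<^esub> v \<oplus>\<^bsub>V\<^esub> lincomb a A"
    using insert.hyps by (simp add: lincomb_def M.finsum_insert)
  moreover have "lincomb a A \<in> carrier V"
    unfolding lincomb_def by (rule M.finsum_closed) (rule sub)
  ultimately show ?case using insert sub by (simp add: g_add g_scale)
qed

text \<open>The bridge between the two notions of basis: the record-based one in
  \<open>loop_basis\<close>, and independence and span of functions. Linear combinations correspond
  because \<open>g\<close> is injective on \<open>A\<close>.\<close>

lemma basis_iff:
  assumes A: "A \<subseteq> carrier V"
  shows "basis A \<longleftrightarrow> bit_fun.independent (g ` A) \<and> bit_fun.span (g ` A) = g ` carrier V"
proof -
  have injA: "inj_on g A" using inj A by (rule inj_on_subset)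
  have lincomb_closed: "lincomb a B \<in> carrier V" if "B \<subseteq> A" for a B
    unfolding lincomb_def using that A by (intro M.finsum_closed) (auto intro: scale_closed)
  have sum_image: "(\<Sum>w\<in>g ` B. bscale (u w) w) = g (lincomb (u \<circ> g) B)" if "finite B" "B \<subseteq> A" for u B
    using that A g_lincomb[of B "u \<circ> g"] by (simp add: sum.reindex[OF inj_on_subset[OF injA]] subset_trans)
  \<comment> \<open>Coefficients on vectors of \<open>B\<close> become coefficients on their images
    through the inverse of \<open>g\<close> on \<open>A\<close>.\<close>
  have sum_image': "g (lincomb a B) = (\<Sum>w\<in>g ` B. bscale (a (inv_into A g w)) w)"
    if B: "finite B" "B \<subseteq> A" for a B
  proof -
    have "(\<Sum>w\<in>g ` B. bscale (a (inv_into A g w)) w) = (\<Sum>v\<in>B. bscale (a (inv_into A g (g v))) (g v))"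
      using B by (simp add: sum.reindex[OF inj_on_subset[OF injA]])
    also have "\<dots> = (\<Sum>v\<in>B. bscale (a v) (g v))"
      using B injA by (intro sum.cong) (auto simp: inv_into_f_f)
    finally show ?thesis using B A g_lincomb[of B a] by simp
  qed
  have "lin_dep A \<longleftrightarrow> bit_fun.dependent (g ` A)"
  proof
    assume "lin_dep A"
    then obtain B a v where B: "finite B" "B \<subseteq> A" "lincomb a B = \<zero>\<^bsub>V\<^esub>" "v \<in> B" "a v \<noteq> 0"
      unfolding lin_dep_def by auto
    show "bit_fun.dependent (g ` A)"
      unfolding bit_fun.dependent_explicit
      using B sum_image'[OF B(1,2), of a] injA
      by (intro exI[of _ "g ` B"] exI[of _ "\<lambda>w. a (inv_into A g w)"])
        (auto simp: g_zero inv_into_f_f subset_iff)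
  next
    assume "bit_fun.dependent (g ` A)"
    then obtain T u where T: "finite T" "T \<subseteq> g ` A" "(\<Sum>v\<in>T. bscale (u v) v) = 0" "\<exists>v\<in>T. u v \<noteq> 0"
      unfolding bit_fun.dependent_explicit by blast
    obtain B where B: "B \<subseteq> A" "finite B" "T = g ` B" using T(1,2) by (metis finite_subset_image)
    have "lincomb (u \<circ> g) B = \<zero>\<^bsub>V\<^esub>"
      using B T sum_image[of B u] by (intro eqI lincomb_closed zero_closed) (simp_all add: g_zero)
    then show "lin_dep A"
      unfolding lin_dep_def using B T(4) by (intro exI[of _ B] exI[of _ "u \<circ> g"]) auto
  qed
  moreover have "g ` span A = bit_fun.span (g ` A)"
  proof (intro equalityI subsetI)
    fix y assume "y \<in> g ` span A"
    then obtain a B where B: "finite B" "B \<subseteq> A" "y = g (lincomb a B)" unfolding span_def by auto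
    then show "y \<in> bit_fun.span (g ` A)"
      using sum_image'[OF B(1,2), of a]
      unfolding bit_fun.span_explicit by (auto intro!: exI[of _ "g ` B"])
  next
    fix y assume "y \<in> bit_fun.span (g ` A)"
    then obtain T u where T: "finite T" "T \<subseteq> g ` A" "y = (\<Sum>v\<in>T. bscale (u v) v)"
      unfolding bit_fun.span_explicit by blast
    obtain B where B: "B \<subseteq> A" "finite B" "T = g ` B" using T(1,2) by (metis finite_subset_image)
    then show "y \<in> g ` span A" using T sum_image[of B u] unfolding span_def by auto
  qed
  moreover have "span A \<subseteq> carrier V" using lincomb_closed unfolding span_def by auto
  then have "span A = carrier V \<longleftrightarrow> g ` span A = g ` carrier V"
    using inj by (simp add: inj_on_image_eq_iff)
  ultimately show ?thesis using A unfolding basis_def by auto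
qed

end

section \<open>Interval sums as spaces of bit-valued functions\<close>

lemma interval_sum_space_simps:
  "carrier (interval_sum_space Is i) = {x. \<forall>j. x j \<noteq> 0 \<longrightarrow> j < length Is \<and> alive (Is ! j) i}"
  "\<zero>\<^bsub>interval_sum_space Is i\<^esub> = 0"
  "x \<oplus>\<^bsub>interval_sum_space Is i\<^esub> y = x + y"
  "a \<odot>\<^bsub>interval_sum_space Is i\<^esub> x = bscale a x"
proof -
  have "(\<forall>j<length Is. x j \<in> interval_carrier (Is ! j) i) \<and> (\<forall>j\<ge>length Is. x j = 0) \<longleftrightarrow>
      (\<forall>j. x j \<noteq> 0 \<longrightarrow> j < length Is \<and> alive (Is ! j) i)" for x :: "nat \<Rightarrow> bit"
    unfolding interval_carrier_def by (metis UNIV_I not_less singletonD singletonI)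
  then show "carrier (interval_sum_space Is i) = {x. \<forall>j. x j \<noteq> 0 \<longrightarrow> j < length Is \<and> alive (Is ! j) i}"
    by (simp add: interval_sum_space_def)
qed (simp_all add: interval_sum_space_def bscale_def plus_fun_def zero_fun_def)

lemma bit_space_embedding_interval_sum:
  "bit_space_embedding (interval_sum_space Is i) (\<lambda>x. x)"
proof -
  let ?V = "interval_sum_space Is i"
  define live where "live j \<longleftrightarrow> j < length Is \<and> alive (Is ! j) i" for j
  have zero: "x j = 0" if "x \<in> carrier ?V" "\<not> live j" for x j
    using that unfolding interval_sum_space_simps live_def by blast
  have closed: "x \<in> carrier ?V" if "\<And>j. \<not> live j \<Longrightarrow> x j = 0" for x
    using that unfolding interval_sum_space_simps live_def by blast
  show ?thesis
    by unfold_locales (auto intro!: closed simp: interval_sum_space_simps(2-) zero bscale_def inj_on_def)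
qed

lemma linear_iso_interval_sumI:
  assumes "bit_space_embedding V \<phi>" "\<phi> ` carrier V = carrier (interval_sum_space Is i)"
  shows "linear_iso V (interval_sum_space Is i) \<phi>"
proof -
  interpret V: bit_space_embedding V \<phi> by fact
  have "\<phi> \<in> LinearCombinations.module_hom F2 V (interval_sum_space Is i)"
    using assms(2)
    unfolding LinearCombinations.module_hom_def
    by (auto simp: V.g_add V.g_scale interval_sum_space_simps(2-))
  then show ?thesis unfolding linear_iso_def linear_map_def mod_hom_def mod_hom_axioms_def bij_betw_def
    using V.vectorspace V.inj assms(2)
      bit_space_embedding.vectorspace[OF bit_space_embedding_interval_sum, of Is i] 
    by (auto simp: vectorspace_def)
qed

text \<open>Modulo 2 the sum \<open>x + y\<close> is also the difference, so this is the coset of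
  \<open>x\<close> once \<open>N\<close> is a subspace.\<close>

definition bit_coset :: "('i \<Rightarrow> bit) set \<Rightarrow> ('i \<Rightarrow> bit) \<Rightarrow> ('i \<Rightarrow> bit) set" where
  "bit_coset N x = {y. x + y \<in> N}"

locale bit_quotient =
  fixes M :: "(bit, 'i \<Rightarrow> bit) module" and N :: "('i \<Rightarrow> bit) set"
  assumes add_eq: "add M = (+)" and smult_eq: "smult M = bscale"
    and subspace_M: "bit_fun.subspace (carrier M)" and subspace_N: "bit_fun.subspace N"
    and N_subset: "N \<subseteq> carrier M"
begin

lemma in_N: "0 \<in> N" "x \<in> N \<Longrightarrow> y \<in> N \<Longrightarrow> x + y \<in> N"
  using subspace_N by (auto simp: bit_fun.subspace_def)

lemma r_coset_eq: "N +>\<^bsub>M\<^esub> x = bit_coset N x"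
proof -
  have "y \<in> N +>\<^bsub>M\<^esub> x \<longleftrightarrow> x + y \<in> N" for y
    unfolding a_r_coset_def' add_eq by (auto simp: add_ac intro!: bexI[of _ "x + y"])
  then show ?thesis by (auto simp: bit_coset_def)
qed

lemma bit_coset_eq_iff: "bit_coset N x = bit_coset N y \<longleftrightarrow> x + y \<in> N"
proof
  assume "bit_coset N x = bit_coset N y"
  then have "y \<in> bit_coset N x" using in_N by (auto simp: bit_coset_def)
  then show "x + y \<in> N" by (simp add: bit_coset_def)
next
  assume xy: "x + y \<in> N"
  have "x + z \<in> N \<longleftrightarrow> y + z \<in> N" for z
    using in_N(2)[OF xy, of "x + z"] in_N(2)[OF xy, of "y + z"] by (auto simp: add_ac)
  then show "bit_coset N x = bit_coset N y" by (simp add: bit_coset_def)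
qed

lemma carrier_quotient: "carrier (quotient_space M N) = bit_coset N ` carrier M"
  by (auto simp: quotient_space_def A_RCOSETS_def' r_coset_eq)

lemma zero_quotient: "\<zero>\<^bsub>quotient_space M N\<^esub> = bit_coset N 0"
  by (simp add: quotient_space_def bit_coset_def)

lemma add_quotient: "bit_coset N x \<oplus>\<^bsub>quotient_space M N\<^esub> bit_coset N y = bit_coset N (x + y)"
proof -
  have "z \<in> bit_coset N x <+>\<^bsub>M\<^esub> bit_coset N y \<longleftrightarrow> x + y + z \<in> N" for z
  proof
    assume "z \<in> bit_coset N x <+>\<^bsub>M\<^esub> bit_coset N y"
    then obtain a b where ab: "x + a \<in> N" "y + b \<in> N" "z = a + b"
      by (auto simp: set_add_def' add_eq bit_coset_def)
    show "x + y + z \<in> N" using in_N(2)[OF ab(1,2)] ab(3) by (simp add: add_ac)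
  next
    assume "x + y + z \<in> N"
    then have "x \<in> bit_coset N x" "x + z \<in> bit_coset N y" "z = x + (x + z)"
      using in_N(1) by (simp_all add: bit_coset_def add_ac)
    then show "z \<in> bit_coset N x <+>\<^bsub>M\<^esub> bit_coset N y"
      unfolding set_add_def' add_eq by blast
  qed
  then show ?thesis by (auto simp: quotient_space_def bit_coset_def)
qed

lemma smult_quotient: "a \<odot>\<^bsub>quotient_space M N\<^esub> bit_coset N x = bit_coset N (bscale a x)"
proof -
  have mem: "x \<in> bit_coset N x" for x using in_N by (simp add: bit_coset_def)
  have "bit_coset N (bscale a y) = bit_coset N (bscale a x)" if "y \<in> bit_coset N x" for y
    using that in_N(1) by (cases a) (simp_all add: bit_coset_eq_iff, simp add: bit_coset_def add.commute)
  then have "(\<Union>y\<in>bit_coset N x. bit_coset N (bscale a y)) = (\<Union>y\<in>bit_coset N x. bit_coset N (bscale a x))"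
    by simp
  then show ?thesis using mem[of x] by (auto simp: quotient_space_def r_coset_eq smult_eq)
qed

context
  fixes \<psi> :: "('i \<Rightarrow> bit) \<Rightarrow> ('j \<Rightarrow> bit)"
  assumes add: "\<And>x y. x \<in> carrier M \<Longrightarrow> y \<in> carrier M \<Longrightarrow> \<psi> (x + y) = \<psi> x + \<psi> y"
    and kernel: "\<And>x. x \<in> carrier M \<Longrightarrow> \<psi> x = 0 \<longleftrightarrow> x \<in> N"
begin

text \<open>A chosen representative differs from \<open>x\<close> by an element of \<open>N\<close>,
  on which \<open>\<psi>\<close> vanishes, so the choice does not affect the value.\<close>

lemma quotient_lift:
  assumes x: "x \<in> carrier M"
  shows "\<psi> (SOME y. y \<in> bit_coset N x) = \<psi> x"
proof -
  let ?y = "SOME y. y \<in> bit_coset N x"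
  have "?y \<in> bit_coset N x"
    by (rule someI[of _ x]) (simp add: bit_coset_def in_N)
  then have xy: "x + ?y \<in> N" by (simp add: bit_coset_def)
  then have xyM: "x + ?y \<in> carrier M" using N_subset by blast
  have "\<psi> (x + (x + ?y)) = \<psi> x + \<psi> (x + ?y)" using x xyM by (rule add)
  then show ?thesis using kernel[OF xyM] xy by simp
qed

text \<open>The first isomorphism theorem: an additive map with kernel \<open>N\<close> descends to
  an injective map on the quotient. It is applied with the identity to the homology of the graph and
  with coordinate maps to that of the power complexes.\<close>

lemma bit_space_embedding_quotient:
  "bit_space_embedding (quotient_space M N) (\<lambda>X. \<psi> (SOME x. x \<in> X))"
proof -
  have closed: "0 \<in> carrier M" "x \<in> carrier M \<Longrightarrow> y \<in> carrier M \<Longrightarrow> x + y \<in> carrier M"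
     "x \<in> carrier M \<Longrightarrow> bscale a x \<in> carrier M" for x y a
    using subspace_M by (auto simp: bit_fun.subspace_def)
  have \<psi>0: "\<psi> 0 = 0" using kernel in_N closed by blast
  show ?thesis
  proof
    show "inj_on (\<lambda>X. \<psi> (SOME x. x \<in> X)) (carrier (quotient_space M N))"
    proof (rule inj_onI)
      fix X Y assume "X \<in> carrier (quotient_space M N)" "Y \<in> carrier (quotient_space M N)"
        and eq: "\<psi> (SOME x. x \<in> X) = \<psi> (SOME x. x \<in> Y)"
      then obtain x y where xy: "X = bit_coset N x" "Y = bit_coset N y" "x \<in> carrier M" "y \<in> carrier M"
        by (auto simp: carrier_quotient)
      then have "\<psi> (x + y) = 0" using eq by (simp add: quotient_lift add)
      then show "X = Y" using xy closed kernel by (simp add: bit_coset_eq_iff)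
    qed
  next
    fix a and X assume "X \<in> carrier (quotient_space M N)"
    then show "\<psi> (SOME x. x \<in> a \<odot>\<^bsub>quotient_space M N\<^esub> X) = bscale a (\<psi> (SOME x. x \<in> X))"
      by (cases a) (auto simp: carrier_quotient smult_quotient quotient_lift closed \<psi>0)
  qed (auto simp: carrier_quotient zero_quotient add_quotient smult_quotient quotient_lift closed \<psi>0 add)
qed

lemma image_quotient_lift:
  "(\<lambda>X. \<psi> (SOME x. x \<in> X)) ` carrier (quotient_space M N) = \<psi> ` carrier M"
  by (force simp: carrier_quotient quotient_lift image_iff)

end

end

section \<open>Chains modulo 2\<close>

lemma sum_apply: "(\<Sum>i\<in>I. f i) x = (\<Sum>i\<in>I. f i x)" for f :: "'i \<Rightarrow> 'a \<Rightarrow> bit"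
  by (induction I rule: infinite_finite_induct) auto

definition single_simplex :: "'v set \<Rightarrow> 'v set \<Rightarrow> bit" where
  "single_simplex s = (\<lambda>t. of_bool (t = s))"

text \<open>The value 0 on a degenerate edge lets walks that return to their start and triangles
  with repeated corners obey the general formulas.\<close>

definition edge_chain :: "'v \<Rightarrow> 'v \<Rightarrow> 'v set \<Rightarrow> bit" where
  "edge_chain u v = (if u = v then 0 else single_simplex {u, v})"

lemma edge_chain_simps [simp]: "edge_chain u u = 0" "u \<noteq> v \<Longrightarrow> edge_chain u v = single_simplex {u, v}"
  by (auto simp: edge_chain_def)

lemma edge_chain_commute: "edge_chain u v = edge_chain v u"
  by (simp add: edge_chain_def insert_commute)

lemma single_simplex_nonzero_iff: "single_simplex s t \<noteq> 0 \<longleftrightarrow> t = s"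
  by (simp add: single_simplex_def)

lemma finite_support_single_simplex [simp]: "finite {t. single_simplex s t \<noteq> 0}"
  unfolding single_simplex_nonzero_iff by simp

lemma chain_eq_sum_single:
  assumes "finite S" "\<And>s. c s \<noteq> 0 \<Longrightarrow> s \<in> S"
  shows "c = (\<Sum>s\<in>S. bscale (c s) (single_simplex s))"
proof
  fix t
  have "(\<Sum>s\<in>S. c s * single_simplex s t) = (\<Sum>s\<in>S. if s = t then c s else 0)"
    by (intro sum.cong) (auto simp: single_simplex_def)
  also have "\<dots> = c t" using assms(1) assms(2)[of t] by (cases "t \<in> S") auto
  finally show "c t = (\<Sum>s\<in>S. bscale (c s) (single_simplex s)) t"
    by (simp add: sum_apply bscale_def)
qed

definition facet :: "'v set \<Rightarrow> 'v set \<Rightarrow> bool" where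
  "facet t s \<longleftrightarrow> t \<noteq> {} \<and> (\<exists>v. v \<notin> t \<and> s = insert v t)"

text \<open>In \<open>boundary\<close> the range of summation depends on the chain. Over a fixed
  finite set containing the support, the sum is visibly linear in the chain.\<close>

lemma boundary_eq_sum:
  assumes "finite S" "\<And>s. c s \<noteq> 0 \<Longrightarrow> s \<in> S"
  shows "boundary c t = (\<Sum>s\<in>S. of_bool (facet t s) * c s)"
proof (cases "t = {}")
  case False
  have "(\<Sum>s\<in>S. of_bool (facet t s) * c s) = (\<Sum>s\<in>{s. c s \<noteq> 0 \<and> facet t s}. of_bool (facet t s) * c s)"
    using assms by (intro sum.mono_neutral_right) auto
  also have "\<dots> = (\<Sum>s\<in>{s. c s \<noteq> 0 \<and> facet t s}. c s)"
    by (intro sum.cong) auto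
  finally show ?thesis using False by (simp add: boundary_def facet_def)
qed (simp add: boundary_def facet_def)

lemma boundary_zero [simp]: "boundary 0 = 0"
  by (simp add: fun_eq_iff boundary_def)

text \<open>Finite supports matter: a sum over an infinite set is 0 by default, which would break
  additivity.\<close>

lemma boundary_add:
  assumes "finite {s. c s \<noteq> 0}" "finite {s. d s \<noteq> 0}"
  shows "boundary (c + d) = boundary c + boundary d"
proof
  fix t
  let ?S = "{s. c s \<noteq> 0} \<union> {s. d s \<noteq> 0}"
  have S: "finite ?S" using assms by simp
  have "boundary c t = (\<Sum>s\<in>?S. of_bool (facet t s) * c s)"
    "boundary d t = (\<Sum>s\<in>?S. of_bool (facet t s) * d s)"
    "boundary (c + d) t = (\<Sum>s\<in>?S. of_bool (facet t s) * (c + d) s)"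
    by (rule boundary_eq_sum[OF S], fastforce)+
  then show "boundary (c + d) t = (boundary c + boundary d) t"
    by (simp add: distrib_left sum.distrib)
qed

lemma subspace_finite_support: "bit_fun.subspace {c. finite {s. c s \<noteq> 0}}"
proof (rule bit_fun_subspaceI)
  fix c d :: "'a \<Rightarrow> bit"
  assume "c \<in> {c. finite {s. c s \<noteq> 0}}" "d \<in> {c. finite {s. c s \<noteq> 0}}"
  then have "finite ({s. c s \<noteq> 0} \<union> {s. d s \<noteq> 0})" by simp
  then have "finite {s. (c + d) s \<noteq> 0}" by (rule finite_subset[rotated]) auto
  then show "c + d \<in> {c. finite {s. c s \<noteq> 0}}" by simp
qed simp

lemma boundary_sum:
  assumes "\<And>i. i \<in> I \<Longrightarrow> finite {s. f i s \<noteq> 0}"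
  shows "boundary (sum f I) = (\<Sum>i\<in>I. boundary (f i))"
  using assms
proof (induction I rule: infinite_finite_induct)
  case (insert i I)
  have "sum f I \<in> {c. finite {s. c s \<noteq> 0}}"
    using insert.prems by (intro bit_fun.subspace_sum[OF subspace_finite_support]) auto
  then have "boundary (f i + sum f I) = boundary (f i) + boundary (sum f I)"
    using insert.prems by (intro boundary_add) auto
  then show ?case using insert.IH insert.prems by (simp only: sum.insert[OF insert.hyps] insertI2)
next
  case empty
  show ?case by (simp only: sum.empty boundary_zero)
next
  case (infinite I)
  show ?case by (simp only: sum.infinite[OF infinite.hyps] boundary_zero)
qed

lemma boundary_single_simplex: "boundary (single_simplex s) t = of_bool (facet t s)"
  by (subst boundary_eq_sum[of "{s}"]) (simp_all add: single_simplex_def split: if_splits)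

lemma boundary_edge_chain: "boundary (edge_chain u v) = single_simplex {u} + single_simplex {v}"
proof (cases "u = v")
  case False
  have "facet t {u, v} \<longleftrightarrow> t = {u} \<or> t = {v}" (is "?L \<longleftrightarrow> ?R") for t
  proof
    assume ?L
    then obtain w where "w \<notin> t" "{u, v} = insert w t" by (auto simp: facet_def)
    then have "t = {u, v} - {w}" "w = u \<or> w = v" by auto
    then show ?R using False by auto
  next
    assume ?R then show ?L using False by (auto simp: facet_def)
  qed
  then have "boundary (single_simplex {u, v}) t = single_simplex {u} t + single_simplex {v} t" for t
    using False unfolding boundary_single_simplex
    by (cases "t = {u}"; cases "t = {v}") (simp_all add: single_simplex_def)
  then show ?thesis using False by (simp add: fun_eq_iff)
qed simp

lemma boundary_triangle:
  assumes "a \<noteq> b" "b \<noteq> c" "a \<noteq> c"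
  shows "boundary (single_simplex {a, b, c}) = edge_chain a b + edge_chain b c + edge_chain a c"
proof -
  have "facet t {a, b, c} \<longleftrightarrow> t = {a, b} \<or> t = {b, c} \<or> t = {a, c}" (is "?L \<longleftrightarrow> ?R") for t
  proof
    assume ?L
    then obtain v where "v \<notin> t" "{a, b, c} = insert v t" by (auto simp: facet_def)
    then have "t = {a, b, c} - {v}" "v = a \<or> v = b \<or> v = c" by auto
    then show ?R using assms by auto
  next
    assume ?R then show ?L using assms by (auto simp: facet_def)
  qed
  moreover have "{a, b} \<noteq> {b, c}" "{a, b} \<noteq> {a, c}" "{b, c} \<noteq> {a, c}"
    using assms by (auto simp: doubleton_eq_iff)
  ultimately have "boundary (single_simplex {a, b, c}) t =
      single_simplex {a, b} t + single_simplex {b, c} t + single_simplex {a, c} t" for t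
    unfolding boundary_single_simplex
    by (cases "t = {a, b}"; cases "t = {b, c}"; cases "t = {a, c}") (simp_all add: single_simplex_def)
  then show ?thesis using assms by (simp add: fun_eq_iff)
qed

section \<open>Chains, cycles and boundaries as subspaces\<close>

lemma chain_space_simps:
  "add (chain_space K k) = (+)" "smult (chain_space K k) = bscale"
  by (auto simp: chain_space_def bscale_def fun_eq_iff)

lemma chain_space_finite: "c \<in> carrier (chain_space K k) \<Longrightarrow> finite {s. c s \<noteq> 0}"
  by (simp add: chain_space_def)

lemma boundary_add_chains:
  "c \<in> carrier (chain_space K k) \<Longrightarrow> d \<in> carrier (chain_space L l) \<Longrightarrow>
    boundary (c + d) = boundary c + boundary d"
  by (intro boundary_add chain_space_finite)

lemma single_simplex_in_chain_space:
  "s \<in> K \<Longrightarrow> card s = Suc k \<Longrightarrow> single_simplex s \<in> carrier (chain_space K k)"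
  using finite_support_single_simplex[of s]
  by (simp add: chain_space_def del: finite_support_single_simplex) (auto simp: single_simplex_def)

lemma subspace_chain_space: "bit_fun.subspace (carrier (chain_space K k))"
proof (rule bit_fun_subspaceI)
  fix c d assume cd: "c \<in> carrier (chain_space K k)" "d \<in> carrier (chain_space K k)"
  have *: "c s \<noteq> 0 \<or> d s \<noteq> 0" if "(c + d) s \<noteq> 0" for s
    using that by (cases "c s") auto
  then have "finite {s. (c + d) s \<noteq> 0}"
    using chain_space_finite[OF cd(1)] chain_space_finite[OF cd(2)]
    by (rule_tac finite_subset[of _ "{s. c s \<noteq> 0} \<union> {s. d s \<noteq> 0}"]) blast+
  moreover have "s \<in> K \<and> card s = Suc k" if "(c + d) s \<noteq> 0" for s
    using *[OF that] cd unfolding chain_space_def by auto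
  ultimately show "c + d \<in> carrier (chain_space K k)" by (simp add: chain_space_def)
qed (simp add: chain_space_def)

lemma subspace_cycles: "bit_fun.subspace (cycles K k)"
proof (rule bit_fun_subspaceI)
  fix x y assume "x \<in> cycles K k" "y \<in> cycles K k"
  then show "x + y \<in> cycles K k"
    using bit_fun.subspace_add[OF subspace_chain_space, of x K k y]
      boundary_add[OF chain_space_finite chain_space_finite, of x K k y K k]
    by (simp add: cycles_def zero_fun_def[symmetric])
qed (use bit_fun.subspace_0[OF subspace_chain_space] in \<open>auto simp: cycles_def zero_fun_def[symmetric]\<close>)

lemma subspace_boundaries: "bit_fun.subspace (boundaries K k)"
proof (rule bit_fun_subspaceI)
  fix x y assume "x \<in> boundaries K k" "y \<in> boundaries K k"
  then obtain c d where c: "c \<in> carrier (chain_space K (Suc k))" "x = boundary c"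
    and d: "d \<in> carrier (chain_space K (Suc k))" "y = boundary d"
    by (auto simp: boundaries_def)
  then have "x + y = boundary (c + d)" by (simp add: boundary_add[OF chain_space_finite chain_space_finite])
  then show "x + y \<in> boundaries K k"
    unfolding boundaries_def using bit_fun.subspace_add[OF subspace_chain_space c(1) d(1)] by blast
next
  show "0 \<in> boundaries K k"
    unfolding boundaries_def by (rule image_eqI[of _ _ 0]) (simp_all add: bit_fun.subspace_0[OF subspace_chain_space])
qed

text \<open>Corners may coincide. In that case one of the edge chains is 0 and the other two cancel,
  so users of this fact need no case distinction.\<close>

lemma triangle_in_boundaries:
  assumes "{a, b, c} \<in> K"
  shows "edge_chain a b + edge_chain b c + edge_chain a c \<in> boundaries K 1"
proof (cases "a \<noteq> b \<and> b \<noteq> c \<and> a \<noteq> c")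
  case True
  then have "single_simplex {a, b, c} \<in> carrier (chain_space K (Suc 1))"
    using assms by (intro single_simplex_in_chain_space) auto
  then show ?thesis
    using True unfolding boundaries_def by (auto simp flip: boundary_triangle simp del: edge_chain_simps)
next
  case False
  then have "edge_chain a b + edge_chain b c + edge_chain a c = 0"
    by (auto simp: edge_chain_commute[of b c] simp del: edge_chain_simps(2))
  then show ?thesis using bit_fun.subspace_0[OF subspace_boundaries] by metis
qed

text \<open>A 2-chain is a finite sum of triangles, so boundaries of triangles generate all
  1-boundaries, and a subspace needs to be tested on them only.\<close>

lemma boundaries_subsetI:
  assumes S: "bit_fun.subspace S"
    and tri: "\<And>a b c. {a, b, c} \<in> K \<Longrightarrow> a \<noteq> b \<Longrightarrow> b \<noteq> c \<Longrightarrow> a \<noteq> c \<Longrightarrow>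
      edge_chain a b + edge_chain b c + edge_chain a c \<in> S"
  shows "boundaries K 1 \<subseteq> S"
proof
  fix z assume "z \<in> boundaries K 1"
  then obtain x where x: "x \<in> carrier (chain_space K (Suc 1))" "z = boundary x"
    unfolding boundaries_def by blast
  have "x = (\<Sum>s\<in>{s. x s \<noteq> 0}. bscale (x s) (single_simplex s))"
    using chain_space_finite[OF x(1)] by (rule chain_eq_sum_single) simp
  also have "\<dots> = (\<Sum>s\<in>{s. x s \<noteq> 0}. single_simplex s)"
    by (intro sum.cong refl) (simp add: bit_not_zero_iff)
  finally have "z = (\<Sum>s\<in>{s. x s \<noteq> 0}. boundary (single_simplex s))"
    using boundary_sum[of "{s. x s \<noteq> 0}" single_simplex] x(2) by simp
  moreover have "boundary (single_simplex s) \<in> S" if "x s \<noteq> 0" for s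
  proof -
    have "s \<in> K" "card s = 3" using x that by (auto simp: chain_space_def)
    then obtain a b c where s: "s = {a, b, c}" "a \<noteq> b" "b \<noteq> c" "a \<noteq> c" by (auto simp: card_3_iff)
    then show ?thesis using tri[of a b c] \<open>s \<in> K\<close> by (simp add: boundary_triangle del: edge_chain_simps)
  qed
  ultimately show "z \<in> S" using bit_fun.subspace_sum[OF S, of "{s. x s \<noteq> 0}"] by simp
qed

section \<open>Chains of walks\<close>

lemma loop_chain_Cons_Cons: "loop_chain (u # v # p) = single_simplex {u, v} + loop_chain (v # p)"
  by (simp add: loop_chain_def single_simplex_def fun_eq_iff eq_commute[of "{u, v}"])

lemma loop_chain_single [simp]: "loop_chain [v] = 0"
  by (simp add: loop_chain_def fun_eq_iff)

lemma loop_chain_join: "joinable p q \<Longrightarrow> loop_chain (vwalk_join p q) = loop_chain p + loop_chain q"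
  by (simp add: loop_chain_def fun_eq_iff vwalk_join_arcs)

lemma loop_chain_snoc: "p \<noteq> [] \<Longrightarrow> loop_chain (p @ [v]) = loop_chain p + single_simplex {last p, v}"
  by (simp add: loop_chain_def fun_eq_iff vwalk_arcs_append single_simplex_def eq_commute[of "{last p, v}"])

lemma loop_chain_rev: "loop_chain (rev p) = loop_chain p"
proof (induction p rule: vwalk_arcs.induct)
  case (3 x y xs)
  have "loop_chain (rev (x # y # xs)) = loop_chain (rev (y # xs)) + single_simplex {y, x}"
    using loop_chain_snoc[of "rev (y # xs)" x] by simp
  then show ?case using 3 by (simp add: loop_chain_Cons_Cons insert_commute add.commute)
qed simp_all

section \<open>Walks and power complexes\<close>

locale connected_graph = pair_graph G for G :: "'v pair_pre_digraph" +
  assumes conn: "Digraph_Component.connected (with_proj G)"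
begin

abbreviation "walk p \<equiv> vwalk p (with_proj G)"
abbreviation "d \<equiv> graph_dist G"
abbreviation "K \<equiv> power_complex G"

lemma walk_Nil [simp]: "\<not> walk []"
  by (simp add: vwalk_def)

lemma walk_verts: "walk p \<Longrightarrow> v \<in> set p \<Longrightarrow> v \<in> pverts G"
  by (auto simp: vwalk_def)

lemma walk_ends: "walk p \<Longrightarrow> hd p \<in> pverts G" "walk p \<Longrightarrow> last p \<in> pverts G"
  by (auto simp: vwalk_def)

lemma walk_rev: "walk p \<Longrightarrow> walk (rev p)"
  using sym_arcs by (rule vwalk_rev_ex)

lemma ex_walk: "u \<in> pverts G \<Longrightarrow> v \<in> pverts G \<Longrightarrow> \<exists>p. walk p \<and> hd p = u \<and> last p = v"
  using conn reachable_mk_symmetric_eq[OF sym_arcs, of u v]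
  unfolding reachable_vwalk_conv[symmetric] by (simp add: connected_def strongly_connected_def)

lemma dist_le: "walk p \<Longrightarrow> d (hd p) (last p) \<le> vwalk_length p"
  unfolding graph_dist_def by (rule Least_le) blast

lemma ex_shortest_walk:
  assumes "u \<in> pverts G" "v \<in> pverts G"
  shows "\<exists>p. walk p \<and> hd p = u \<and> last p = v \<and> vwalk_length p = d u v"
  unfolding graph_dist_def using LeastI_ex[of "\<lambda>n. \<exists>p. walk p \<and> hd p = u \<and> last p = v \<and> vwalk_length p = n"]
    ex_walk[OF assms] by blast

lemma dist_self: "v \<in> pverts G \<Longrightarrow> d v v = 0"
  using dist_le[of "[v]"] by simp

lemma dist_commute_le:
  assumes "u \<in> pverts G" "v \<in> pverts G"
  shows "d v u \<le> d u v"
proof -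
  obtain p where p: "walk p" "hd p = u" "last p = v" "vwalk_length p = d u v"
    using ex_shortest_walk[OF assms] by blast
  then show ?thesis using dist_le[OF walk_rev, of p] by (simp add: hd_rev last_rev)
qed

lemma dist_commute: "u \<in> pverts G \<Longrightarrow> v \<in> pverts G \<Longrightarrow> d v u = d u v"
  by (intro antisym dist_commute_le)

lemma dist_eq_0_imp: 
  assumes "u \<in> pverts G" "v \<in> pverts G" "d u v = 0" 
  shows "u = v"
proof -
  obtain p where p: "walk p" "hd p = u" "last p = v" "vwalk_length p = 0"
    using ex_shortest_walk[OF assms(1,2)] assms(3) by auto
  then show ?thesis by (cases p) auto
qed

lemma dist_arc: "(u, v) \<in> parcs G \<Longrightarrow> d u v = 1"
  using dist_le[of "[u, v]"] dist_eq_0_imp[of u v] no_loops'[of u v]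
  by (cases "d u v") (auto simp: in_arcsD1 in_arcsD2)

lemma dist_le_diam: 
  assumes "u \<in> pverts G" "v \<in> pverts G" 
  shows "d u v \<le> graph_diam G"
proof -
  have "{d u v |u v. u \<in> pverts G \<and> v \<in> pverts G} = (\<lambda>(u, v). d u v) ` (pverts G \<times> pverts G)"
    by auto
  then have "finite {d u v |u v. u \<in> pverts G \<and> v \<in> pverts G}"
    using pair_finite_verts by simp
  then show ?thesis unfolding graph_diam_def using assms by (intro Max_ge) auto
qed

text \<open>The stretch of the walk between two of its positions is itself a walk. Hence the
  vertices of a walk of length at most \<open>n\<close> form a simplex of the \<open>n\<close>-th
  power complex.\<close>

lemma dist_le_walk:
  assumes p: "walk p" and uv: "u \<in> set p" "v \<in> set p"
  shows "d u v \<le> vwalk_length p"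
proof -
  have le: "d (p ! i) (p ! j) \<le> vwalk_length p" if "i \<le> j" "j < length p" for i j
  proof -
    let ?q = "take (Suc (j - i)) (drop i p)"
    have "walk (drop i p)"
      using p that vwalkI_append_r[of "drop i p" "take i p"] by simp
    then have "walk ?q"
      using that vwalkI_append_l[of ?q "drop (Suc (j - i)) (drop i p)"] by (simp del: drop_drop)
    then have "d (hd ?q) (last ?q) \<le> vwalk_length ?q" by (rule dist_le)
    moreover have len: "length ?q = Suc (j - i)" using that by simp
    then have "?q \<noteq> []" by (metis list.size(3) nat.distinct(1))
    then have "last ?q = p ! j" using len that by (subst last_conv_nth) simp_all
    moreover have "hd ?q = p ! i" "vwalk_length ?q \<le> vwalk_length p"
      using that by (auto simp: hd_drop_conv_nth)
    ultimately show ?thesis by simp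
  qed
  obtain i j where ij: "i < length p" "j < length p" "u = p ! i" "v = p ! j"
    using uv by (auto simp: in_set_conv_nth)
  then show ?thesis
    using le[of i j] le[of j i] dist_commute[of "p ! j" "p ! i"] walk_verts[OF p, of "p ! i"] walk_verts[OF p, of "p ! j"]
    by (cases "i \<le> j") auto
qed

lemma power_complex_iff:
  "s \<in> K n \<longleftrightarrow> s \<noteq> {} \<and> s \<subseteq> pverts G \<and> (\<forall>u\<in>s. \<forall>v\<in>s. d u v \<le> n)"
  unfolding power_complex_def using pair_finite_verts by (auto intro: finite_subset)

lemma arc_in_power_complex: "(u, v) \<in> parcs G \<Longrightarrow> 1 \<le> n \<Longrightarrow> {u, v} \<in> K n"
  using arcs_symmetric[of u v] by (auto simp: power_complex_iff dist_arc dist_self in_arcsD1 in_arcsD2)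

text \<open>The boundary telescopes: consecutive edges share a vertex, which cancels modulo
  2.\<close>

lemma boundary_loop_chain:
  assumes "walk p"
  shows "boundary (loop_chain p) = single_simplex {hd p} + single_simplex {last p} \<and>
    loop_chain p \<in> carrier (chain_space (graph_complex G) 1)"
  using assms
proof (induction p rule: vwalk_induct)
  case (Base u)
  show "boundary (loop_chain [u]) = single_simplex {hd [u]} + single_simplex {last [u]} \<and>
      loop_chain [u] \<in> carrier (chain_space (graph_complex G) 1)"
    by (simp add: bit_fun.subspace_0[OF subspace_chain_space])
next
  case (Cons u v es)
  then have uv: "(u, v) \<in> parcs G" "u \<noteq> v" using no_loops'[of u v] by auto
  then have s: "single_simplex {u, v} \<in> carrier (chain_space (graph_complex G) 1)"
    by (intro single_simplex_in_chain_space) (auto simp: graph_complex_def)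
  have "boundary (single_simplex {u, v}) = single_simplex {u} + single_simplex {v}"
    using boundary_edge_chain[of u v] uv by simp
  moreover have IH: "boundary (loop_chain (v # es)) = single_simplex {v} + single_simplex {last (v # es)}"
    "loop_chain (v # es) \<in> carrier (chain_space (graph_complex G) 1)"
    using Cons.IH by auto
  ultimately have "boundary (single_simplex {u, v} + loop_chain (v # es)) =
      single_simplex {u} + single_simplex {last (v # es)}"
    using boundary_add[OF chain_space_finite[OF s] chain_space_finite[OF IH(2)]] by (simp add: add.assoc)
  then show "boundary (loop_chain (u # v # es)) =
      single_simplex {hd (u # v # es)} + single_simplex {last (u # v # es)} \<and>
      loop_chain (u # v # es) \<in> carrier (chain_space (graph_complex G) 1)"
    unfolding loop_chain_Cons_Cons
    using bit_fun.subspace_add[OF subspace_chain_space s IH(2)] by simp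
qed

text \<open>This cycle space serves as the first homology of \<open>G\<close>: a graph has no
  2-simplices, so there is nothing to divide out (\<open>boundaries_graph\<close>).\<close>

definition Z :: "('v set \<Rightarrow> bit) set" where "Z = cycles (graph_complex G) 1"

lemma subspace_Z: "bit_fun.subspace Z"
  unfolding Z_def by (rule subspace_cycles)

lemma loop_chain_in_Z: "is_loop G p \<Longrightarrow> loop_chain p \<in> Z"
  using boundary_loop_chain[of p] by (auto simp: is_loop_def Z_def cycles_def zero_fun_def)

lemma graph_chain_in_power_chains:
  assumes "1 \<le> n"
  shows "carrier (chain_space (graph_complex G) 1) \<subseteq> carrier (chain_space (K n) 1)"
proof -
  have "s \<in> K n" if "s \<in> graph_complex G" for s
    using that arc_in_power_complex[OF _ assms]
    by (auto simp: graph_complex_def) (auto simp: power_complex_iff dist_self)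
  then show ?thesis unfolding chain_space_def by auto
qed

lemma Z_in_cycles: "1 \<le> n \<Longrightarrow> Z \<subseteq> cycles (K n) 1"
  using graph_chain_in_power_chains[of n] by (auto simp: Z_def cycles_def)

lemma walk_induct [consumes 1, case_names Base Cons]:
  assumes "walk p" "\<And>u. u \<in> pverts G \<Longrightarrow> P [u]"
    "\<And>u v p. (u, v) \<in> parcs G \<Longrightarrow> walk (v # p) \<Longrightarrow> walk (u # v # p) \<Longrightarrow> P (v # p) \<Longrightarrow> P (u # v # p)"
  shows "P p"
  using assms(1)
proof (induction p rule: vwalk_arcs.induct)
  case (3 x y xs)
  then show ?case using assms(3) by simp
qed (use assms(2) in auto)

text \<open>The walk is coned off from its last vertex: each of its edges spans a (possibly
  degenerate) simplex with that vertex, and the boundaries of these triangles add up to the walk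
  plus its chord. The bound is on distances rather than on length, so that for \<open>n\<close> the
  diameter it covers arbitrarily long walks.\<close>

lemma walk_homologous_edge:
  assumes "walk p" "\<And>u v. u \<in> set p \<Longrightarrow> v \<in> set p \<Longrightarrow> d u v \<le> n"
  shows "edge_chain (hd p) (last p) + loop_chain p \<in> boundaries (K n) 1"
  using assms
proof (induction p rule: walk_induct)
  case (Base u)
  show "edge_chain (hd [u]) (last [u]) + loop_chain [u] \<in> boundaries (K n) 1"
    by (simp add: bit_fun.subspace_0[OF subspace_boundaries])
next
  case (Cons u v es)
  let ?w = "last (v # es)"
  note walk = \<open>walk (u # v # es)\<close>
  have w: "last (u # v # es) = ?w" by simp
  have "{u, v, ?w} \<subseteq> set (u # v # es)" by auto
  then have "{u, v, ?w} \<in> K n"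
    using Cons.prems walk_verts[OF walk] unfolding power_complex_iff by blast
  then have "edge_chain u v + edge_chain v ?w + edge_chain u ?w \<in> boundaries (K n) 1"
    by (rule triangle_in_boundaries)
  moreover have "edge_chain v ?w + loop_chain (v # es) \<in> boundaries (K n) 1"
    using Cons.IH Cons.prems by fastforce
  \<comment> \<open>The edge from \<open>v\<close> to the apex occurs in both summands and
    cancels.\<close>
  ultimately have "edge_chain u v + edge_chain v ?w + edge_chain u ?w + (edge_chain v ?w + loop_chain (v # es)) \<in> boundaries (K n) 1"
    by (rule bit_fun.subspace_add[OF subspace_boundaries])
  moreover have "u \<noteq> v" using Cons.hyps no_loops'[of u v] by auto
  ultimately show "edge_chain (hd (u # v # es)) (last (u # v # es)) + loop_chain (u # v # es) \<in> boundaries (K n) 1"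
    by (simp add: loop_chain_Cons_Cons add_ac)
qed

end

section \<open>Replacing edges by shortest paths\<close>

context connected_graph begin

lemma short_walk_homologous_edge:
  "walk p \<Longrightarrow> vwalk_length p \<le> n \<Longrightarrow> edge_chain (hd p) (last p) + loop_chain p \<in> boundaries (K n) 1"
  using dist_le_walk by (intro walk_homologous_edge) (auto intro: order_trans)

text \<open>The cut is made after \<open>a\<close> edges. A walk with fewer edges than that is its
  own first piece, followed by the constant walk at its end.\<close>

lemma split_walk:
  assumes "walk p" "vwalk_length p \<le> a + b"
  obtains q r where "walk q" "walk r" "joinable q r" "p = vwalk_join q r"
    "vwalk_length q \<le> a" "vwalk_length r \<le> b"
proof (cases "a < length p")
  case True
  \<comment> \<open>The pieces overlap in the vertex at position \<open>a\<close>, as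
    \<open>joinable\<close> requires.\<close>
  let ?q = "take (Suc a) p" and ?r = "drop a p"
  have "last ?q = hd ?r" using True by (simp add: take_Suc_conv_app_nth hd_drop_conv_nth)
  then have "joinable ?q ?r" using True by (intro joinableI) auto
  moreover have "p = vwalk_join ?q ?r" by (simp add: vwalk_join_def) (metis append_take_drop_id drop_Suc tl_drop)
  moreover have "walk ?q" "walk ?r"
    using assms(1) True vwalkI_append_l[of ?q "drop (Suc a) p"] vwalkI_append_r[of ?r "take a p"]
    by auto
  ultimately show ?thesis using assms(2) by (intro that[of ?q ?r]) auto
next
  case False
  then show ?thesis using assms walk_ends[of p]
    by (intro that[of p "[last p]"]) (auto simp: vwalk_join_def)
qed

lemma short_loop_in_boundaries:
  assumes p: "is_loop G p" "vwalk_length p \<le> 3 * n"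
  shows "loop_chain p \<in> boundaries (K n) 1"
proof -
  have "walk p" "last p = hd p" using p by (auto simp: is_loop_def)
  obtain q t where q: "walk q" "walk t" "joinable q t" "p = vwalk_join q t" "vwalk_length q \<le> n" "vwalk_length t \<le> n + n"
    using split_walk[OF \<open>walk p\<close>, of n "n + n"] p(2) by auto
  obtain r s where r: "walk r" "walk s" "joinable r s" "t = vwalk_join r s" "vwalk_length r \<le> n" "vwalk_length s \<le> n"
    using split_walk[OF q(2,6)] by blast
  define a b c where "a = hd q" "b = hd r" "c = hd s"
  have ends: "hd q = a" "last q = b" "hd r = b" "last r = c" "hd s = c" "last s = a"
    using q(3) r(3) \<open>last p = hd p\<close> unfolding q(4) r(4) a_b_c_def
    by (auto simp: joinable_def vwalk_join_hd' vwalk_join_last)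
  have verts: "a \<in> pverts G" "b \<in> pverts G" "c \<in> pverts G"
    using walk_ends(1)[OF q(1)] walk_ends(1)[OF r(1)] walk_ends(1)[OF r(2)] ends by auto
  have "d a b \<le> n" "d b c \<le> n" "d c a \<le> n"
    using dist_le[OF q(1)] dist_le[OF r(1)] dist_le[OF r(2)] q(5) r(5,6) unfolding ends by linarith+
  then have "{a, b, c} \<in> K n"
    using verts dist_self dist_commute[of a b] dist_commute[of b c] dist_commute[of c a]
    unfolding power_complex_iff by auto
  then have "edge_chain a b + edge_chain b c + edge_chain a c \<in> boundaries (K n) 1"
    by (rule triangle_in_boundaries)
  \<comment> \<open>To the triangle is added each arc closed up by its chord. Every chord then
    occurs twice, and the loop alone remains.\<close>
  then have "edge_chain a b + edge_chain b c + edge_chain a c + (edge_chain a b + loop_chain q) +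
      (edge_chain b c + loop_chain r) + (edge_chain c a + loop_chain s) \<in> boundaries (K n) 1"
    using short_walk_homologous_edge[OF q(1,5)] short_walk_homologous_edge[OF r(1,5)]
      short_walk_homologous_edge[OF r(2,6)] bit_fun.subspace_add[OF subspace_boundaries]
    unfolding ends by blast
  moreover have "loop_chain p = loop_chain q + (loop_chain r + loop_chain s)"
    unfolding q(4) loop_chain_join[OF q(3)] unfolding r(4) loop_chain_join[OF r(3)] ..
  ultimately show ?thesis by (simp add: edge_chain_commute[of c a] add_ac)
qed

text \<open>All distances are at most the diameter, so the coning argument applies to a loop of any
  length; its chord is the degenerate edge 0.\<close>

lemma loop_in_boundaries_diam:
  "is_loop G p \<Longrightarrow> loop_chain p \<in> boundaries (K (graph_diam G)) 1"
  using walk_homologous_edge[of p "graph_diam G"] dist_le_diam walk_verts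
  by (auto simp: is_loop_def)

text \<open>The argument is an unordered pair, matching the simplices of a chain, so the chosen
  shortest walk may run in either direction.\<close>

definition path_chain :: "'v set \<Rightarrow> 'v set \<Rightarrow> bit" where
  "path_chain s = loop_chain
    (SOME p. walk p \<and> {hd p, last p} = s \<and> vwalk_length p = d (hd p) (last p))"

lemma ex_path_chain:
  assumes "u \<in> pverts G" "v \<in> pverts G"
  shows "\<exists>p. walk p \<and> hd p = u \<and> last p = v \<and> vwalk_length p = d u v \<and> path_chain {u, v} = loop_chain p"
proof -
  let ?P = "\<lambda>p. walk p \<and> {hd p, last p} = {u, v} \<and> vwalk_length p = d (hd p) (last p)"
  define p where "p = (SOME p. ?P p)"
  have "?P p" unfolding p_def by (rule someI_ex) (use ex_shortest_walk[OF assms] in blast)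
  then have p: "walk p" "vwalk_length p = d (hd p) (last p)" "hd p = u \<and> last p = v \<or> hd p = v \<and> last p = u"
    by (auto simp: doubleton_eq_iff)
  have "path_chain {u, v} = loop_chain p" by (simp add: path_chain_def p_def)
  show ?thesis
  proof (cases "hd p = u \<and> last p = v")
    case True
    then show ?thesis using p \<open>path_chain {u, v} = loop_chain p\<close> by metis
  next
    \<comment> \<open>The chosen walk runs from \<open>v\<close> to \<open>u\<close>; its reversal
      has the same chain.\<close>
    case False
    then have "hd (rev p) = u" "last (rev p) = v" "vwalk_length (rev p) = d u v"
      using p assms dist_commute by (auto simp: hd_rev last_rev)
    then show ?thesis using walk_rev[OF p(1)] \<open>path_chain {u, v} = loop_chain p\<close> loop_chain_rev by metis
  qed
qed

text \<open>A shortest walk between adjacent vertices has one edge and is therefore the arc itself.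
  This makes \<open>retract\<close> the identity on chains of \<open>G\<close>.\<close>

lemma path_chain_arc:
  assumes "(u, v) \<in> parcs G"
  shows "path_chain {u, v} = single_simplex {u, v}"
proof -
  obtain p where p: "hd p = u" "last p = v" "vwalk_length p = 1" "path_chain {u, v} = loop_chain p"
    using ex_path_chain[of u v] dist_arc[OF assms] assms in_arcsD1 in_arcsD2 by metis
  then have "length p = 2" by simp
  then obtain x y where "p = [x, y]" by (auto simp: length_Suc_conv numeral_2_eq_2)
  then show ?thesis using p by (simp add: loop_chain_Cons_Cons)
qed

section \<open>The retraction onto the graph\<close>

definition vertex_pairs :: "'v set set" where
  "vertex_pairs = {s. s \<subseteq> pverts G \<and> card s = 2}"

lemma finite_vertex_pairs: "finite vertex_pairs"
  using pair_finite_verts by (auto simp: vertex_pairs_def intro: finite_subset[of _ "Pow (pverts G)"])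

text \<open>Summing over all pairs of vertices, a finite set, and not over the support of
  \<open>x\<close> makes the map additive without side conditions and independent of the index of
  the power complex.\<close>

definition retract :: "('v set \<Rightarrow> bit) \<Rightarrow> 'v set \<Rightarrow> bit" where
  "retract x = (\<Sum>s\<in>vertex_pairs. bscale (x s) (path_chain s))"

lemma retract_add: "retract (x + y) = retract x + retract y"
  by (simp add: retract_def bit_fun.scale_left_distrib sum.distrib)

lemma retract_0: "retract 0 = 0"
  by (simp add: retract_def)

lemma retract_single:
  assumes "s \<in> vertex_pairs"
  shows "retract (single_simplex s) = path_chain s"
proof -
  have "retract (single_simplex s) = (\<Sum>t\<in>vertex_pairs. if t = s then path_chain t else 0)"
    unfolding retract_def by (intro sum.cong) (auto simp: single_simplex_def)
  then show ?thesis using assms finite_vertex_pairs by simp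
qed

lemma path_chain_in_graph: 
  assumes "s \<in> vertex_pairs"
  shows "path_chain s \<in> carrier (chain_space (graph_complex G) 1)"
proof -
  obtain u v where s: "s = {u, v}" "u \<in> pverts G" "v \<in> pverts G"
    using assms by (auto simp: vertex_pairs_def card_2_iff)
  show ?thesis using ex_path_chain[OF s(2,3)] boundary_loop_chain s(1) by metis
qed

lemma retract_in_graph: "retract x \<in> carrier (chain_space (graph_complex G) 1)"
  unfolding retract_def
  by (intro bit_fun.subspace_sum[OF subspace_chain_space] bit_fun.subspace_scale[OF subspace_chain_space]
      path_chain_in_graph)

lemma one_chain_expand:
  assumes "x \<in> carrier (chain_space L 1)" "\<And>s. s \<in> L \<Longrightarrow> s \<subseteq> pverts G"
  shows "x = (\<Sum>s\<in>vertex_pairs. bscale (x s) (single_simplex s))"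
  using finite_vertex_pairs assms
  by (intro chain_eq_sum_single) (auto simp: chain_space_def vertex_pairs_def)

lemma retract_homologous:
  assumes x: "x \<in> carrier (chain_space (K n) 1)"
  shows "x + retract x \<in> boundaries (K n) 1"
proof -
  have "x + retract x = (\<Sum>s\<in>vertex_pairs. bscale (x s) (single_simplex s)) + retract x"
    using one_chain_expand[OF x] by (simp add: power_complex_iff)
  also have "\<dots> = (\<Sum>s\<in>vertex_pairs. bscale (x s) (single_simplex s + path_chain s))"
    by (simp add: retract_def sum.distrib bit_fun.scale_right_distrib)
  also have "\<dots> \<in> boundaries (K n) 1"
  proof (rule bit_fun.subspace_sum[OF subspace_boundaries])
    fix s assume "s \<in> vertex_pairs"
    then obtain u v where s: "s = {u, v}" "u \<in> pverts G" "v \<in> pverts G" "u \<noteq> v"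
      by (auto simp: vertex_pairs_def card_2_iff)
    show "bscale (x s) (single_simplex s + path_chain s) \<in> boundaries (K n) 1"
    proof (cases "x s = 0")
      case False
      then have "s \<in> K n" using x by (auto simp: chain_space_def)
      then have "d u v \<le> n" using s by (auto simp: power_complex_iff)
      moreover obtain p where "walk p" "hd p = u" "last p = v" "vwalk_length p = d u v" "path_chain {u, v} = loop_chain p"
        using ex_path_chain[OF s(2,3)] by blast
      ultimately have "edge_chain u v + path_chain {u, v} \<in> boundaries (K n) 1"
        using short_walk_homologous_edge[of p n] by simp
      then show ?thesis using s by (intro bit_fun.subspace_scale[OF subspace_boundaries]) simp
    qed (simp add: bit_fun.subspace_0[OF subspace_boundaries])
  qed
  finally show ?thesis .
qed

lemma retract_graph:
  assumes x: "x \<in> carrier (chain_space (graph_complex G) 1)"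
  shows "retract x = x"
proof -
  have "x = (\<Sum>s\<in>vertex_pairs. bscale (x s) (single_simplex s))"
    using one_chain_expand[OF x] in_arcsD1 in_arcsD2 by (auto simp: graph_complex_def)
  also have "\<dots> = (\<Sum>s\<in>vertex_pairs. bscale (x s) (path_chain s))"
  proof (rule sum.cong[OF refl])
    fix s assume s: "s \<in> vertex_pairs"
    show "bscale (x s) (single_simplex s) = bscale (x s) (path_chain s)"
    proof (cases "x s = 0")
      case False
      then have "s \<in> graph_complex G" "card s = 2" using x by (auto simp: chain_space_def)
      then obtain u v where "s = {u, v}" "(u, v) \<in> parcs G" by (auto simp: graph_complex_def)
      then show ?thesis by (simp add: path_chain_arc)
    qed simp
  qed
  finally show ?thesis by (simp add: retract_def)
qed

definition loop_span :: "nat \<Rightarrow> ('v set \<Rightarrow> bit) set" where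
  "loop_span n = bit_fun.span {loop_chain p |p. is_loop G p \<and> vwalk_length p \<le> n}"

lemma retract_boundaries:
  assumes "x \<in> boundaries (K n) 1"
  shows "retract x \<in> loop_span (3 * n)"
proof -
  have "boundaries (K n) 1 \<subseteq> {x. retract x \<in> loop_span (3 * n)}"
  proof (rule boundaries_subsetI)
    show "bit_fun.subspace {x. retract x \<in> loop_span (3 * n)}"
      by (rule bit_fun_subspaceI) (auto simp: retract_0 retract_add loop_span_def bit_fun.span_zero bit_fun.span_add)
  next
    fix a b c assume abc: "{a, b, c} \<in> K n" "a \<noteq> b" "b \<noteq> c" "a \<noteq> c"
    then have v: "a \<in> pverts G" "b \<in> pverts G" "c \<in> pverts G" and dist: "d a b \<le> n" "d b c \<le> n" "d c a \<le> n"
      by (auto simp: power_complex_iff)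
    obtain p where p: "walk p" "hd p = a" "last p = b" "vwalk_length p = d a b" "path_chain {a, b} = loop_chain p"
      using ex_path_chain[OF v(1,2)] by blast
    obtain q where q: "walk q" "hd q = b" "last q = c" "vwalk_length q = d b c" "path_chain {b, c} = loop_chain q"
      using ex_path_chain[OF v(2,3)] by blast
    obtain r where r: "walk r" "hd r = c" "last r = a" "vwalk_length r = d c a" "path_chain {c, a} = loop_chain r"
      using ex_path_chain[OF v(3,1)] by blast
    have jqr: "joinable q r" using q r by (intro joinableI) auto
    then have jp: "joinable p (vwalk_join q r)"
      using p q by (intro joinableI) (auto simp: vwalk_join_hd)
    let ?l = "vwalk_join p (vwalk_join q r)"
    have "walk ?l"
      using p(1) q(1) r(1) jp jqr by (intro vwalk_joinI_vwalk)
    moreover have "hd ?l = a" "last ?l = a" using jp jqr p q r by (simp_all add: vwalk_join_hd vwalk_join_last)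
    moreover have "vwalk_length ?l \<le> 3 * n"
      using dist p(4) q(4) r(4) vwalk_join_vwalk_length[OF jp] vwalk_join_vwalk_length[OF jqr] by linarith
    ultimately have "loop_chain ?l \<in> loop_span (3 * n)"
      unfolding loop_span_def by (intro bit_fun.span_base) (auto simp: is_loop_def)
    moreover have "loop_chain ?l = path_chain {a, b} + path_chain {b, c} + path_chain {a, c}"
      using p q r jp jqr by (simp add: loop_chain_join insert_commute add.assoc)
    moreover have "{a, b} \<in> vertex_pairs" "{b, c} \<in> vertex_pairs" "{a, c} \<in> vertex_pairs"
      using v abc by (auto simp: vertex_pairs_def)
    ultimately show "edge_chain a b + edge_chain b c + edge_chain a c \<in> {x. retract x \<in> loop_span (3 * n)}"
      using abc by (simp add: retract_add retract_single)
  qed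
  then show ?thesis using assms by blast
qed

text \<open>Each corner of a triangle lies on two of its sides, so the boundary of the three sides
  cancels.\<close>

lemma boundaries_subset_cycles: "boundaries (K n) 1 \<subseteq> cycles (K n) 1"
proof (rule boundaries_subsetI[OF subspace_cycles])
  fix a b c assume abc: "{a, b, c} \<in> K n" "a \<noteq> b" "b \<noteq> c" "a \<noteq> c"
  have "edge_chain a b \<in> carrier (chain_space (K n) 1)"
    "edge_chain b c \<in> carrier (chain_space (K n) 1)"
    and ac: "edge_chain a c \<in> carrier (chain_space (K n) 1)"
    using abc by (auto intro!: single_simplex_in_chain_space simp: power_complex_iff)
  note ab = this(1,2)
  let ?x = "edge_chain a b + edge_chain b c + edge_chain a c"
  note bc = bit_fun.subspace_add[OF subspace_chain_space ab]
  note x = bit_fun.subspace_add[OF subspace_chain_space bc ac]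
  have "boundary ?x = boundary (edge_chain a b) + boundary (edge_chain b c) + boundary (edge_chain a c)"
    unfolding boundary_add_chains[OF bc ac] boundary_add_chains[OF ab] ..
  then have "boundary ?x = 0" by (simp only: boundary_edge_chain) (simp add: add_ac)
  then show "?x \<in> cycles (K n) 1" unfolding cycles_def zero_fun_def[symmetric] using x by blast
qed

text \<open>The retract of a cycle differs from it by a boundary, hence is again a cycle. This
  spares a proof that \<open>retract\<close> commutes with \<open>boundary\<close>.\<close>

lemma retract_in_Z:
  assumes "x \<in> cycles (K n) 1"
  shows "retract x \<in> Z"
proof -
  have x: "x \<in> carrier (chain_space (K n) 1)" using assms by (simp add: cycles_def)
  have "x + (x + retract x) \<in> cycles (K n) 1"
    using bit_fun.subspace_add[OF subspace_cycles assms] retract_homologous[OF x] boundaries_subset_cycles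
    by blast
  then show ?thesis using retract_in_graph by (simp add: cycles_def Z_def)
qed

end

section \<open>Greedy property of lexicographically shortest bases\<close>

declare vwalk_length_simp [simp del]

text \<open>After re-sorting, the entries up to the place where \<open>y\<close> lands are
  unchanged, and there \<open>y\<close> replaces something larger. This is the strict decrease that
  contradicts minimality in the exchange argument.\<close>

lemma sort_list_update_less:
  fixes xs :: "nat list"
  assumes "sorted xs" "j < length xs" "y < xs ! j"
  shows "\<not> ord_class.lexordp_eq xs (sort (xs[j := y]))"
  using assms
proof (induction xs arbitrary: j)
  case (Cons x xs)
  show ?case
  proof (cases j)
    case 0
    then have "sort ((x # xs)[j := y]) = y # xs"
      using Cons.prems insort_is_Cons[of xs "\<lambda>z. z" y] by (fastforce simp: sorted_sort_id)
    then show ?thesis using Cons.prems 0 by simp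
  next
    case (Suc i)
    then have up: "(x # xs)[j := y] = x # xs[i := y]" and i: "i < length xs" "y < xs ! i"
      using Cons.prems by auto
    show ?thesis
    proof (cases "y < x")
      case True
      \<comment> \<open>The new head is at most \<open>y\<close>, thus below the old head
        \<open>x\<close>.\<close>
      obtain h t where ht: "sort (x # xs[i := y]) = h # t" by (cases "sort (x # xs[i := y])") auto
      then have "set (h # t) = set (x # xs[i := y])" by (metis set_sort)
      then have "y \<in> set (h # t)" using i by (auto simp: set_update_memI)
      moreover have "sorted (h # t)" using ht by (metis sorted_sort)
      ultimately have "h \<le> y" by auto
      then show ?thesis using True unfolding up ht by simp
    next
      case False
      have "x \<le> z" if "z \<in> set (xs[i := y])" for z
        using that False Cons.prems(1) set_update_subset_insert[of xs i y] by auto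
      then have "sort (x # xs[i := y]) = x # sort (xs[i := y])"
        by (simp add: insort_is_Cons)
      then show ?thesis using Cons.IH[OF _ i] Cons.prems(1) unfolding up by simp
    qed
  qed
qed simp

lemma map_sort_key: "map f (sort_key f xs) = sort (map f xs)"
  by (intro properties_for_sort[symmetric]) simp_all

section \<open>Homology groups as quotients of function spaces\<close>

lemma homology_class_eq: "homology_class k L c = bit_coset (boundaries L k) c"
proof -
  have "y \<in> homology_class k L c \<longleftrightarrow> c + y \<in> boundaries L k" for y
    unfolding homology_class_def a_r_coset_def' chain_space_simps
    by (auto simp: add_ac intro!: bexI[of _ "c + y"])
  then show ?thesis by (auto simp: bit_coset_def)
qed

abbreviation cycle_space :: "'v set set \<Rightarrow> nat \<Rightarrow> (bit, 'v set \<Rightarrow> bit) module" where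
  "cycle_space L k \<equiv> (chain_space L k)\<lparr>carrier := cycles L k\<rparr>"

lemma bit_quotient_homology:
  assumes "boundaries L k \<subseteq> cycles L k"
  shows "bit_quotient (cycle_space L k) (boundaries L k)"
  using assms by unfold_locales (auto simp: chain_space_simps subspace_cycles subspace_boundaries)

lemma boundaries_mono: "L \<subseteq> L' \<Longrightarrow> boundaries L k \<subseteq> boundaries L' k"
  unfolding boundaries_def chain_space_def by (intro image_mono) auto

lemma cycles_mono: "L \<subseteq> L' \<Longrightarrow> cycles L k \<subseteq> cycles L' k"
  unfolding cycles_def chain_space_def by auto

context connected_graph begin

lemma boundaries_graph: "boundaries (graph_complex G) 1 = {0}"
proof
  show "boundaries (graph_complex G) 1 \<subseteq> {0}"
  proof (rule boundaries_subsetI)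
    fix a b c assume abc: "{a, b, c} \<in> graph_complex G" "a \<noteq> b" "b \<noteq> c" "a \<noteq> c"
    then have "card {a, b, c} = 3" by simp
    moreover have "card s \<le> 2" if "s \<in> graph_complex G" for s
      using that by (auto simp: graph_complex_def card_insert_if)
    ultimately show "edge_chain a b + edge_chain b c + edge_chain a c \<in> {0}"
      using abc(1) by fastforce
  qed simp
qed (use bit_fun.subspace_0[OF subspace_boundaries] in blast)

text \<open>Without 2-simplices every class is a singleton, so choosing its element identifies the
  homology of \<open>G\<close> with \<open>Z\<close> and the class of a loop with its chain.\<close>

lemma loop_basis_iff:
  "loop_basis G \<gamma> \<longleftrightarrow> (\<forall>p\<in>set \<gamma>. is_loop G p) \<and> distinct (map loop_chain \<gamma>) \<and>
    bit_fun.independent (set (map loop_chain \<gamma>)) \<and> bit_fun.span (set (map loop_chain \<gamma>)) = Z"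
proof (cases "\<forall>p\<in>set \<gamma>. is_loop G p")
  case True
  let ?g = "\<lambda>X. (SOME x. x \<in> X) :: 'v set \<Rightarrow> bit"
  let ?H = "homology 1 (graph_complex G)"
  have "boundaries (graph_complex G) 1 \<subseteq> cycles (graph_complex G) 1"
    using boundaries_graph bit_fun.subspace_0[OF subspace_cycles] by auto
  then interpret Q: bit_quotient "cycle_space (graph_complex G) 1" "boundaries (graph_complex G) 1"
    by (rule bit_quotient_homology)
  have ker: "x = 0 \<longleftrightarrow> x \<in> boundaries (graph_complex G) 1" for x :: "'v set \<Rightarrow> bit"
    unfolding boundaries_graph by simp
  interpret E: bit_space_embedding ?H ?g
    unfolding homology_def by (rule Q.bit_space_embedding_quotient[of "\<lambda>x. x", OF refl ker])
  have image: "?g ` carrier ?H = Z"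
    using Q.image_quotient_lift[of "\<lambda>x. x", OF refl ker] by (simp add: homology_def Z_def)
  have loop: "loop_class G p \<in> carrier ?H \<and> ?g (loop_class G p) = loop_chain p" if "p \<in> set \<gamma>" for p
  proof -
    have "loop_chain p \<in> cycles (graph_complex G) 1"
      using loop_chain_in_Z True that by (auto simp: Z_def)
    then show ?thesis
      using Q.quotient_lift[of "\<lambda>x. x", OF refl ker, of "loop_chain p"] Q.carrier_quotient
      unfolding loop_class_def homology_class_eq homology_def by auto
  qed
  have "loop_class G p = loop_class G q \<longleftrightarrow> loop_chain p = loop_chain q" if "p \<in> set \<gamma>" "q \<in> set \<gamma>" for p q
    using loop[OF that(1)] loop[OF that(2)] E.eqI[of "loop_class G p" "loop_class G q"] by auto
  then have "distinct (map (loop_class G) \<gamma>) \<longleftrightarrow> distinct (map loop_chain \<gamma>)"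
    by (simp add: distinct_map inj_on_def)
  moreover have "?g ` set (map (loop_class G) \<gamma>) = set (map loop_chain \<gamma>)"
    using loop by (simp add: image_image cong: image_cong)
  moreover have "set (map (loop_class G) \<gamma>) \<subseteq> carrier ?H" using loop by auto
  ultimately show ?thesis
    using E.basis_iff[of "set (map (loop_class G) \<gamma>)"] image True unfolding loop_basis_def by simp
qed (auto simp: loop_basis_def)

text \<open>Otherwise the expansion of \<open>p\<close> in the basis involves a member longer than
  \<open>l\<close>. Putting \<open>p\<close> in its place gives another basis with one length
  lowered, against lexicographic minimality.\<close>

lemma lex_shortest_spans_short_loops:
  assumes lex: "lex_shortest_loop_basis G \<gamma>" and p: "is_loop G p" "vwalk_length p \<le> l"
  shows "loop_chain p \<in> bit_fun.span (loop_chain ` {q \<in> set \<gamma>. vwalk_length q \<le> l})"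
proof (rule ccontr)
  let ?S = "loop_chain ` {q \<in> set \<gamma>. vwalk_length q \<le> l}"
  assume notin: "loop_chain p \<notin> bit_fun.span ?S"
  define B where "B = set (map loop_chain \<gamma>)"
  have basis: "\<forall>q\<in>set \<gamma>. is_loop G q" "distinct (map loop_chain \<gamma>)" "bit_fun.independent B" "bit_fun.span B = Z"
    and sorted: "sorted (map vwalk_length \<gamma>)"
    using lex by (auto simp: lex_shortest_loop_basis_def loop_basis_iff B_def)
  have pZ: "loop_chain p \<in> bit_fun.span B" using loop_chain_in_Z[OF p(1)] basis(4) by simp
  let ?r = "bit_fun.representation B (loop_chain p)"
  have "\<exists>b. ?r b \<noteq> 0 \<and> b \<notin> ?S"
  proof (rule ccontr)
    assume "\<nexists>b. ?r b \<noteq> 0 \<and> b \<notin> ?S"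
    then have "(\<Sum>b | ?r b \<noteq> 0. bscale (?r b) b) \<in> bit_fun.span ?S"
      by (intro bit_fun.span_sum bit_fun.span_scale bit_fun.span_base) blast
    then show False using notin bit_fun.sum_nonzero_representation_eq[OF basis(3) pZ] by simp
  qed
  then obtain b where b: "?r b \<noteq> 0" "b \<notin> ?S" by blast
  have "b \<in> B" using b(1) by (rule bit_fun.representation_ne_zero)
  then obtain j where j: "j < length \<gamma>" "b = loop_chain (\<gamma> ! j)"
    by (auto simp: B_def in_set_conv_nth)
  then have len: "vwalk_length p < vwalk_length (\<gamma> ! j)" using b(2) p(2) by force
  \<comment> \<open>Coordinates are unique, so a nonzero one at \<open>b\<close> keeps
    \<open>p\<close> out of the span of the other members. This gives both independence after the
    swap and the recovery of \<open>b\<close> from the new basis.\<close>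
  have notin': "loop_chain p \<notin> bit_fun.span (B - {b})"
  proof
    assume "loop_chain p \<in> bit_fun.span (B - {b})"
    then have "?r = bit_fun.representation (B - {b}) (loop_chain p)"
      by (intro bit_fun.representation_extend basis(3)) auto
    then show False using b(1) bit_fun.representation_ne_zero by fastforce
  qed
  \<comment> \<open>Minimality compares sorted length lists only, so the swapped list is sorted
    again.\<close>
  define \<gamma>' where "\<gamma>' = sort_key vwalk_length (\<gamma>[j := p])"
  have set': "set (map loop_chain (\<gamma>[j := p])) = insert (loop_chain p) (B - {b})"
    using set_update_distinct[OF basis(2), of j] j by (simp add: map_update B_def)
  have not_in_B: "loop_chain p \<notin> B - {b}" using notin' bit_fun.span_base[of "loop_chain p" "B - {b}"] by argo
  have "distinct (map loop_chain (\<gamma>[j := p]))"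
    unfolding map_update using basis(2)
  proof (rule distinct_list_update)
    show "loop_chain p \<notin> set (map loop_chain \<gamma>) - {map loop_chain \<gamma> ! j}"
      using not_in_B j by (simp add: B_def)
  qed
  then have dist': "distinct (map loop_chain \<gamma>')"
    by (simp add: \<gamma>'_def distinct_map)
  have set'': "set (map loop_chain \<gamma>') = insert (loop_chain p) (B - {b})"
    using set' unfolding \<gamma>'_def by simp
  have ind': "bit_fun.independent (insert (loop_chain p) (B - {b}))"
    using notin' basis(3) by (intro bit_fun.independent_insertI) (auto intro: bit_fun.dependent_mono)
  have "b \<in> bit_fun.span (insert (loop_chain p) (B - {b}))"
    using pZ notin' by (rule bit_fun.in_span_delete)
  then have "B \<subseteq> bit_fun.span (insert (loop_chain p) (B - {b}))"
    using bit_fun.span_superset[of "insert (loop_chain p) (B - {b})"] by blast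
  then have "Z \<subseteq> bit_fun.span (insert (loop_chain p) (B - {b}))"
    unfolding basis(4)[symmetric] by (rule bit_fun.span_minimal[OF _ bit_fun.subspace_span])
  moreover have "bit_fun.span (insert (loop_chain p) (B - {b})) \<subseteq> Z"
    using pZ bit_fun.span_superset[of B] basis(4)
    by (intro bit_fun.span_minimal subspace_Z) auto
  ultimately have "loop_basis G \<gamma>'"
    unfolding loop_basis_iff set'' using ind' dist' basis(1) p(1) set_update_subset_insert[of \<gamma> j p]
    by (auto simp: \<gamma>'_def)
  moreover have "sorted (map vwalk_length \<gamma>')" by (simp add: \<gamma>'_def)
  ultimately have "ord_class.lexordp_eq (map vwalk_length \<gamma>) (map vwalk_length \<gamma>')"
    using lex by (auto simp: lex_shortest_loop_basis_def)
  moreover have "map vwalk_length \<gamma>' = sort ((map vwalk_length \<gamma>)[j := vwalk_length p])"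
    by (simp add: \<gamma>'_def map_sort_key map_update)
  ultimately show False
    using sort_list_update_less[OF sorted, of j "vwalk_length p"] j len by simp
qed

lemma power_complex_mono: "i \<le> j \<Longrightarrow> K i \<subseteq> K j"
  unfolding power_complex_iff subset_iff by (meson order_trans)

text \<open>Distinct vertices have positive distance, so the complex at index 0 has no edges. This
  is why no interval starts before 1.\<close>

lemma cycles_power_0: "cycles (K 0) 1 = {0}"
proof -
  have "c s = 0" if c: "c \<in> cycles (K 0) 1" for c s
  proof (rule ccontr)
    assume "c s \<noteq> 0"
    then have "s \<in> K 0" "card s = 2" using c by (auto simp: cycles_def chain_space_def)
    then obtain u v where "u \<noteq> v" "s = {u, v}" "u \<in> pverts G" "v \<in> pverts G" "d u v = 0"
      by (auto simp: card_2_iff power_complex_iff)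
    then show False using dist_eq_0_imp by blast
  qed
  then show ?thesis using bit_fun.subspace_0[OF subspace_cycles] by (auto simp: fun_eq_iff)
qed

end

section \<open>The interval decomposition\<close>

text \<open>The rounding in the theorem is confined to this fact: a member of the basis is still
  alive at \<open>i\<close> exactly when it is longer than \<open>3 * i\<close>.\<close>

lemma less_nat_ceiling_third_iff: "i < nat \<lceil>real l / 3\<rceil> \<longleftrightarrow> 3 * i < l"
proof -
  have "i < nat \<lceil>real l / 3\<rceil> \<longleftrightarrow> real i < real l / 3"
    by (simp add: zless_nat_eq_int_zless less_ceiling_iff)
  also have "\<dots> \<longleftrightarrow> 3 * i < l" by linarith
  finally show ?thesis .
qed

locale shortest_loop_basis = connected_graph G for G :: "'v pair_pre_digraph" +
  fixes \<gamma> :: "'v vwalk list"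
  assumes lex: "lex_shortest_loop_basis G \<gamma>"
begin

definition B :: "('v set \<Rightarrow> bit) set" where "B = loop_chain ` set \<gamma>"

definition death :: "'v vwalk \<Rightarrow> nat" where "death p = nat \<lceil>real (vwalk_length p) / 3\<rceil>"

text \<open>The discarded members already bound at index 1. They are the diagonal points and would
  give empty intervals.\<close>

definition \<delta> :: "'v vwalk list" where "\<delta> = filter (\<lambda>p. death p \<noteq> 1) \<gamma>"

definition intervals :: "(nat \<times> enat) list" where
  "intervals = map (\<lambda>p. (1, enat (death p))) \<delta>"

lemma basis:
  "p \<in> set \<gamma> \<Longrightarrow> is_loop G p" "distinct (map loop_chain \<gamma>)" "bit_fun.independent B" "bit_fun.span B = Z"
  using lex by (auto simp: lex_shortest_loop_basis_def loop_basis_iff B_def)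

lemma loop_chain_inj: "p \<in> set \<gamma> \<Longrightarrow> q \<in> set \<gamma> \<Longrightarrow> loop_chain p = loop_chain q \<Longrightarrow> p = q"
  using basis(2) by (auto simp: distinct_map inj_on_def)

abbreviation "coord \<equiv> bit_fun.representation B"

abbreviation "short_chains l \<equiv> loop_chain ` {q \<in> set \<gamma>. vwalk_length q \<le> l}"

lemma loop_span_eq: "loop_span l = bit_fun.span (short_chains l)"
proof
  show "loop_span l \<subseteq> bit_fun.span (short_chains l)"
    unfolding loop_span_def
    by (intro bit_fun.span_minimal) (auto intro: lex_shortest_spans_short_loops[OF lex])
  show "bit_fun.span (short_chains l) \<subseteq> loop_span l"
    unfolding loop_span_def using basis(1) by (intro bit_fun.span_mono) auto
qed

text \<open>The span of the short loops is that of the short members of the basis, and by uniqueness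
  of coordinates an element of it involves no longer member.\<close>

lemma coord_loop_span:
  assumes "x \<in> loop_span l" "p \<in> set \<gamma>" "l < vwalk_length p"
  shows "coord x (loop_chain p) = 0"
proof (rule ccontr)
  assume "coord x (loop_chain p) \<noteq> 0"
  moreover have "coord x = bit_fun.representation (short_chains l) x"
    using assms(1) unfolding loop_span_eq
    by (intro bit_fun.representation_extend basis(3)) (auto simp: B_def)
  ultimately have "loop_chain p \<in> short_chains l"
    using bit_fun.representation_ne_zero[of "short_chains l" x "loop_chain p"] by argo
  then show False using assms(2,3) loop_chain_inj by fastforce
qed

text \<open>Every loop bounds at the diameter, so a basis loop longer than three times the diameter
  would have coordinate 0 at itself, where it has 1.\<close>

lemma death_le_diam:
  assumes "p \<in> set \<gamma>"
  shows "death p \<le> graph_diam G"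
proof (rule ccontr)
  assume "\<not> death p \<le> graph_diam G"
  then have "3 * graph_diam G < vwalk_length p" by (simp add: death_def less_nat_ceiling_third_iff not_le)
  moreover have "retract (loop_chain p) = loop_chain p"
    using loop_chain_in_Z[OF basis(1)[OF assms]] by (intro retract_graph) (simp add: Z_def cycles_def)
  then have "loop_chain p \<in> loop_span (3 * graph_diam G)"
    using retract_boundaries[OF loop_in_boundaries_diam[OF basis(1)[OF assms]]] by simp
  ultimately have "coord (loop_chain p) (loop_chain p) = 0"
    using assms by (intro coord_loop_span)
  then show False
    using bit_fun.representation_basis[OF basis(3), of "loop_chain p"] assms by (simp add: B_def)
qed

text \<open>A loop of length 0 has chain 0, which no independent set contains. Together with the
  filter in \<open>\<delta>\<close>, every remaining death exceeds the birth 1.\<close>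

lemma death_pos:
  assumes "p \<in> set \<gamma>"
  shows "0 < death p"
proof -
  have "loop_chain p \<noteq> 0" using basis(3) bit_fun.dependent_zero[of B] assms unfolding B_def by force
  moreover have "loop_chain p = 0" if "vwalk_length p = 0"
  proof -
    have "p \<noteq> []" using basis(1)[OF assms] by (auto simp: is_loop_def)
    then obtain v where "p = [v]" using \<open>vwalk_length p = 0\<close> by (cases p) (auto simp: vwalk_length_simp)
    then show ?thesis by simp
  qed
  ultimately show ?thesis unfolding death_def less_nat_ceiling_third_iff by auto
qed

lemma set_\<delta>: "set \<delta> = {p \<in> set \<gamma>. death p \<noteq> 1}"
  by (auto simp: \<delta>_def)

lemma length_intervals [simp]: "length intervals = length \<delta>"
  by (simp add: intervals_def)

lemma valid_intervals: "\<forall>I\<in>set intervals. valid_interval (graph_diam G) I"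
proof
  fix I assume "I \<in> set intervals"
  then obtain p where p: "p \<in> set \<gamma>" "death p \<noteq> 1" "I = (1, enat (death p))"
    by (auto simp: intervals_def set_\<delta>)
  then show "valid_interval (graph_diam G) I"
    using death_pos[OF p(1)] death_le_diam[OF p(1)] by (simp add: valid_interval_def one_enat_def)
qed

lemma alive_iff:
  "j < length \<delta> \<Longrightarrow> alive (intervals ! j) i \<longleftrightarrow> 1 \<le> i \<and> 3 * i < vwalk_length (\<delta> ! j)"
  by (simp add: intervals_def alive_def death_def less_nat_ceiling_third_iff)

text \<open>For \<open>i \<ge> 1\<close> the coordinates kept are those at members longer than
  \<open>3 * i\<close>; the others belong to loops that already bound at index
  \<open>i\<close>.\<close>

definition \<psi> :: "nat \<Rightarrow> ('v set \<Rightarrow> bit) \<Rightarrow> nat \<Rightarrow> bit" where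
  "\<psi> i x = (\<lambda>j. if j < length \<delta> \<and> alive (intervals ! j) i then coord (retract x) (loop_chain (\<delta> ! j)) else 0)"

lemma retract_in_span: "x \<in> cycles (K i) 1 \<Longrightarrow> retract x \<in> bit_fun.span B"
  using retract_in_Z basis(4) by simp

lemma \<psi>_add:
  assumes "x \<in> cycles (K i) 1" "y \<in> cycles (K i) 1"
  shows "\<psi> i (x + y) = \<psi> i x + \<psi> i y"
proof -
  have "coord (retract x + retract y) b = coord (retract x) b + coord (retract y) b" for b
    by (subst bit_fun.representation_add[OF basis(3)]) (use assms retract_in_span in auto)
  then show ?thesis by (auto simp: \<psi>_def retract_add fun_eq_iff)
qed

text \<open>Boundaries retract into the span of loops of length at most \<open>3 * i\<close>, where
  the kept coordinates vanish. Conversely, if these vanish, the retract is a combination of loops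
  that bound, and \<open>x\<close> is homologous to its retract.\<close>

lemma \<psi>_kernel:
  assumes x: "x \<in> cycles (K i) 1"
  shows "\<psi> i x = 0 \<longleftrightarrow> x \<in> boundaries (K i) 1"
proof
  assume "x \<in> boundaries (K i) 1"
  then have "retract x \<in> loop_span (3 * i)" by (rule retract_boundaries)
  then have "coord (retract x) (loop_chain (\<delta> ! j)) = 0" if "j < length \<delta>" "alive (intervals ! j) i" for j
    using that nth_mem[OF that(1)] by (intro coord_loop_span) (auto simp: alive_iff set_\<delta>)
  then show "\<psi> i x = 0" by (auto simp: \<psi>_def fun_eq_iff)
next
  assume \<psi>: "\<psi> i x = 0"
  show "x \<in> boundaries (K i) 1"
  proof (cases "i = 0")
    case True
    then show ?thesis using x cycles_power_0 bit_fun.subspace_0[OF subspace_boundaries] by auto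
  next
    case False
    have "b \<in> boundaries (K i) 1" if b: "coord (retract x) b \<noteq> 0" for b
    proof -
      have "b \<in> B" using b by (rule bit_fun.representation_ne_zero)
      then obtain p where p: "p \<in> set \<gamma>" "b = loop_chain p" by (auto simp: B_def)
      have "vwalk_length p \<le> 3 * i"
      proof (rule ccontr)
        assume long: "\<not> vwalk_length p \<le> 3 * i"
        then have "i < death p" by (simp add: death_def less_nat_ceiling_third_iff)
        \<comment> \<open>As \<open>1 \<le> i < death p\<close>, the member \<open>p\<close> was not
          filtered out.\<close>
        then have "p \<in> set \<delta>" using p(1) False by (auto simp: set_\<delta>)
        then obtain j where j: "j < length \<delta>" "p = \<delta> ! j" by (auto simp: in_set_conv_nth)
        then have "\<psi> i x j = coord (retract x) b" using long False p by (simp add: \<psi>_def alive_iff)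
        then show False using \<psi> b by simp
      qed
      then show ?thesis using short_loop_in_boundaries[OF basis(1)] p by simp
    qed
    then have "(\<Sum>b | coord (retract x) b \<noteq> 0. bscale (coord (retract x) b) b) \<in> boundaries (K i) 1"
      by (intro bit_fun.subspace_sum[OF subspace_boundaries] bit_fun.subspace_scale[OF subspace_boundaries]) auto
    then have r: "retract x \<in> boundaries (K i) 1"
      using bit_fun.sum_nonzero_representation_eq[OF basis(3) retract_in_span[OF x]] by simp
    have "x + retract x \<in> boundaries (K i) 1"
      using x by (intro retract_homologous) (simp add: cycles_def)
    then have "(x + retract x) + retract x \<in> boundaries (K i) 1"
      using r by (rule bit_fun.subspace_add[OF subspace_boundaries])
    then show ?thesis by (simp add: add.assoc)
  qed
qed

lemma \<psi>_image: "\<psi> i ` cycles (K i) 1 = carrier (interval_sum_space intervals i)"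
proof (intro equalityI subsetI)
  fix y assume "y \<in> carrier (interval_sum_space intervals i)"
  then have y: "j < length \<delta> \<and> alive (intervals ! j) i" if "y j \<noteq> 0" for j
    using that by (auto simp: interval_sum_space_simps)
  \<comment> \<open>The preimage is the combination of basis loops with coefficients
    \<open>y\<close>; as a cycle of \<open>G\<close> it is fixed by \<open>retract\<close>.\<close>
  define x where "x = (\<Sum>j<length \<delta>. bscale (y j) (loop_chain (\<delta> ! j)))"
  have loop: "\<delta> ! j \<in> set \<gamma>" if "j < length \<delta>" for j
    using nth_mem[OF that] by (simp add: set_\<delta>)
  have xZ: "x \<in> Z" unfolding x_def
    using loop loop_chain_in_Z basis(1)
    by (intro bit_fun.subspace_sum[OF subspace_Z] bit_fun.subspace_scale[OF subspace_Z]) auto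
  then have retract: "retract x = x" by (intro retract_graph) (simp add: Z_def cycles_def)
  have "x \<in> cycles (K i) 1"
  proof (cases "i = 0")
    case True
    \<comment> \<open>Cycles of \<open>G\<close> are not chains of the edgeless complex at index 0,
      but no interval is alive there, so \<open>y\<close> and \<open>x\<close> vanish.\<close>
    then have "y j = 0" if "j < length \<delta>" for j using y[of j] alive_iff[OF that, of i] by auto
    then have "x = 0" by (simp add: x_def)
    then show ?thesis using bit_fun.subspace_0[OF subspace_cycles] by simp
  qed (use Z_in_cycles[of i] xZ in auto)
  moreover have "\<psi> i x = y"
  proof
    fix k
    have "coord x (loop_chain (\<delta> ! k)) = y k" if k: "k < length \<delta>"
    proof -
      have inB: "loop_chain (\<delta> ! j) \<in> B" if "j < length \<delta>" for j using loop[OF that] by (simp add: B_def)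
      have dist: "distinct (map loop_chain \<delta>)"
        using basis(2) unfolding \<delta>_def by (rule distinct_map_filter)
      have "coord x = (\<lambda>b. \<Sum>j<length \<delta>. coord (bscale (y j) (loop_chain (\<delta> ! j))) b)"
        unfolding x_def using inB
        by (intro bit_fun.representation_sum basis(3) bit_fun.span_scale bit_fun.span_base) auto
      then have "coord x (loop_chain (\<delta> ! k)) =
          (\<Sum>j<length \<delta>. coord (bscale (y j) (loop_chain (\<delta> ! j))) (loop_chain (\<delta> ! k)))" by simp
      also have "\<dots> = (\<Sum>j<length \<delta>. if j = k then y j else 0)"
      proof (rule sum.cong[OF refl])
        fix j assume "j \<in> {..<length \<delta>}"
        then have j: "j < length \<delta>" by simp
        have "loop_chain (\<delta> ! k) = loop_chain (\<delta> ! j) \<longleftrightarrow> k = j"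
          using dist j k by (auto simp: distinct_conv_nth)
        then show "coord (bscale (y j) (loop_chain (\<delta> ! j))) (loop_chain (\<delta> ! k)) = (if j = k then y j else 0)"
          using bit_fun.representation_scale[OF basis(3) bit_fun.span_base[OF inB[OF j]]]
            bit_fun.representation_basis[OF basis(3) inB[OF j]] by auto
      qed
      finally show ?thesis using k by simp
    qed
    then show "\<psi> i x k = y k" using y[of k] retract by (auto simp: \<psi>_def)
  qed
  ultimately show "y \<in> \<psi> i ` cycles (K i) 1" by blast
qed (auto simp: \<psi>_def interval_sum_space_simps split: if_splits)

text \<open>For \<open>i \<ge> 1\<close> the retract stays the same and only the mask shrinks. At
  \<open>i = 0\<close> the mask grows, because all intervals are born at 1, but the only cycle is
  0.\<close>

lemma \<psi>_Suc:
  assumes x: "x \<in> cycles (K i) 1"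
  shows "\<psi> (Suc i) x = interval_sum_map intervals i (\<psi> i x)"
proof
  fix j
  have "coord (retract x) b = 0" if "i = 0" for b
    using x that cycles_power_0 by (simp add: retract_0 bit_fun.representation_zero)
  then show "\<psi> (Suc i) x j = interval_sum_map intervals i (\<psi> i x) j"
    by (cases "i = 0") (auto simp: \<psi>_def interval_sum_map_def interval_map_def alive_iff)
qed

lemma homology_quotient: "bit_quotient (cycle_space (K i) 1) (boundaries (K i) 1)"
  by (rule bit_quotient_homology[OF boundaries_subset_cycles])

lemma carrier_homology: "carrier (homology 1 (K i)) = bit_coset (boundaries (K i) 1) ` cycles (K i) 1"
  using bit_quotient.carrier_quotient[OF homology_quotient] by (simp add: homology_def)

lemma inclusion_map_coset:
  assumes "x \<in> cycles (K i) 1"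
  shows "inclusion_map 1 (K (Suc i)) (bit_coset (boundaries (K i) 1) x) = bit_coset (boundaries (K (Suc i)) 1) x"
proof -
  interpret Q: bit_quotient "cycle_space (K (Suc i)) 1" "boundaries (K (Suc i)) 1"
    by (rule homology_quotient)
  have "bit_coset (boundaries (K (Suc i)) 1) y = bit_coset (boundaries (K (Suc i)) 1) x"
    if "y \<in> bit_coset (boundaries (K i) 1) x" for y
    using that boundaries_mono[OF power_complex_mono[of i "Suc i"], of 1]
    unfolding Q.bit_coset_eq_iff by (auto simp: bit_coset_def add.commute)
  moreover have "x \<in> bit_coset (boundaries (K i) 1) x"
    using bit_fun.subspace_0[OF subspace_boundaries] by (simp add: bit_coset_def)
  ultimately show ?thesis unfolding inclusion_map_def homology_class_eq by blast
qed

lemma interval_decomposition_power: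
  "interval_decomposition (graph_diam G) (\<lambda>i. homology 1 (K i)) (\<lambda>i. inclusion_map 1 (K (Suc i))) intervals"
  unfolding interval_decomposition_def
proof (intro conjI exI[of _ "\<lambda>i X. \<psi> i (SOME x. x \<in> X)"] allI impI ballI)
  have lift: "\<psi> i (SOME y. y \<in> bit_coset (boundaries (K i) 1) x) = \<psi> i x" if "x \<in> cycles (K i) 1" for i x
    using bit_quotient.quotient_lift[OF homology_quotient, of i "\<psi> i"] \<psi>_add \<psi>_kernel that by simp
  {
    fix i
    have "bit_space_embedding (homology 1 (K i)) (\<lambda>X. \<psi> i (SOME x. x \<in> X))"
      using bit_quotient.bit_space_embedding_quotient[OF homology_quotient, of i "\<psi> i"] \<psi>_add \<psi>_kernel
      by (simp add: homology_def)
    moreover have "(\<lambda>X. \<psi> i (SOME x. x \<in> X)) ` carrier (homology 1 (K i)) = carrier (interval_sum_space intervals i)"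
      using bit_quotient.image_quotient_lift[OF homology_quotient, of i "\<psi> i"] \<psi>_add \<psi>_kernel \<psi>_image
      by (simp add: homology_def)
    ultimately show "linear_iso (homology 1 (K i)) (interval_sum_space intervals i) (\<lambda>X. \<psi> i (SOME x. x \<in> X))"
      by (rule linear_iso_interval_sumI)
  }
  fix i X assume "X \<in> carrier (homology 1 (K i))"
  then obtain x where x: "x \<in> cycles (K i) 1" "X = bit_coset (boundaries (K i) 1) x"
    unfolding carrier_homology by blast
  have x': "x \<in> cycles (K (Suc i)) 1" using x(1) cycles_mono[OF power_complex_mono[of i "Suc i"]] by auto
  show "\<psi> (Suc i) (SOME x. x \<in> inclusion_map 1 (K (Suc i)) X) =
      interval_sum_map intervals i (\<psi> i (SOME x. x \<in> X))"
    unfolding x(2) inclusion_map_coset[OF x(1)] lift[OF x(1)] lift[OF x'] by (rule \<psi>_Suc[OF x(1)])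
qed (use valid_intervals in blast)

lemma PD_eq_intervals: "PD 1 G = mset intervals"
  unfolding PD_def
proof (rule persistence_diagram_eqI[OF interval_decomposition_power])
  fix i X assume "X \<in> carrier (homology 1 (K i))"
  then show "inclusion_map 1 (K (Suc i)) X \<in> carrier (homology 1 (K (Suc i)))"
    using cycles_mono[OF power_complex_mono[of i "Suc i"], of 1] inclusion_map_coset
    unfolding carrier_homology by auto
qed

end

theorem theorem3p3:
  fixes G :: "'v pair_pre_digraph" and \<gamma> :: "'v vwalk list" and m :: nat
  assumes "pair_graph G"
    and "Digraph_Component.connected (with_proj G)"
    and "m = vectorspace.dim F2 (homology 1 (graph_complex G))"
    and "lex_shortest_loop_basis G \<gamma>"
    and "length \<gamma> = m"
  shows "PD 1 G =
    filter_mset (\<lambda>(b, d). enat b \<noteq> d)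
      (image_mset (\<lambda>i. (1, enat (nat \<lceil>real (vwalk_length (\<gamma> ! i)) / 3\<rceil>))) (mset_set {..<m}))"
proof -
  interpret shortest_loop_basis G \<gamma>
    using assms by (simp add: shortest_loop_basis_def connected_graph_def connected_graph_axioms_def
        shortest_loop_basis_axioms_def)
  let ?I = "\<lambda>p. (1 :: nat, enat (death p))"
  have nth: "map (\<lambda>i. ?I (\<gamma> ! i)) [0..<length \<gamma>] = map ?I \<gamma>"
    by (rule nth_equalityI) simp_all
  have image: "image_mset (\<lambda>i. ?I (\<gamma> ! i)) (mset_set {..<m}) = mset (map ?I \<gamma>)"
    unfolding assms(5)[symmetric] nth[symmetric] by (simp only: mset_map mset_upt lessThan_atLeast0)
  \<comment> \<open>The points on the diagonal are exactly those with \<open>death p = 1\<close>,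
    the members missing from \<open>\<delta>\<close>.\<close>
  have filter: "filter (\<lambda>(b, d). enat b \<noteq> d) (map ?I \<gamma>) = intervals"
    unfolding intervals_def \<delta>_def filter_map
    by (intro arg_cong[of _ _ "map ?I"] filter_cong) (auto simp: one_enat_def)
  show ?thesis
    unfolding death_def[symmetric] image mset_filter[symmetric] filter by (rule PD_eq_intervals)
qed

end
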